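(* Let $\mathcal{H}$ be a real Hilbert space, $N\ge 1$, and for $i=1,\dots,N$ let $A_i:\mathcal{H}\rightrightarrows\mathcal{H}$ be maximally monotone and $B_i:\mathcal{H}\to\mathcal{H}$ be monotone and $L_i$-Lipschitz continuous. Suppose $\big(\sum_{i=1}^N (A_i+B_i)\big)^{-1}(0)\neq\varnothing$. Let $W$ be a mixing matrix for a connected graph on $\{1,\dots,N\}$, let $\alpha_1,\dots,\alpha_N$ satisfy $0<\alpha_i<1/(8L_i)$, set $\Lambda=\mathrm{diag}(\alpha_1,\dots,\alpha_N)$, choose $\beta$ with $0<\beta<\|\Lambda^{1/2}((I-W)/2)\Lambda^{1/2}\|^{-1}$, and set $\widetilde W = I-(\beta/2)\Lambda(I-W)$. Choose $\mathbf{y}^0,\mathbf{z}^0\in\mathcal{H}^N$, set $\mathbf{v}^0=B(\mathbf{y}^0)$, and define $\mathbf{x}^0=J_{\Lambda A}(\mathbf{z}^0)$, $\mathbf{y}^1=2\mathbf{x}^0-\mathbf{z}^0-\Lambda\mathbf{v}^0$, $\mathbf{z}^1=\mathbf{y}^1+\mathbf{z}^0-\mathbf{x}^0$, $\mathbf{x}^1=J_{\Lambda A}(\mathbf{z}^1)$, and for all $k\ge 1$: $\mathbf{v}^k=2B(\mathbf{y}^k)-B(\mathbf{y}^{k-1})$, $\mathbf{z}^{k+1}=\mathbf{z}^k-\mathbf{x}^k+\widetilde W\big(2\mathbf{x}^k-\mathbf{x}^{k-1}-\Lambda(\mathbf{v}^k-\mathbf{v}^{k-1})\big)$, $\mathbf{x}^{k+1}=J_{\Lambda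 A}(\mathbf{z}^{k+1})$, $\mathbf{y}^{k+1}=\mathbf{x}^k+\mathbf{z}^{k+1}-\mathbf{z}^k$. Then: (i) $\mathbf{z}^k\rightharpoonup\mathbf{z}^*$ for some $\mathbf{z}^*\in\mathcal{H}^N$; (ii) $\mathbf{x}^k\rightharpoonup\mathbf{x}^*$ and $\mathbf{y}^k\rightharpoonup\mathbf{x}^*$, where $\mathbf{x}^*=J_{\Lambda A}(\mathbf{z}^* )$; (iii) $\mathbf{x}^*=(x^*,\dots,x^* )\in\mathcal{H}^N$ with $x^*\in\big(\sum_{i=1}^N (A_i+B_i)\big)^{-1}(0)$.
   Context: $\rightharpoonup$ denotes weak convergence. $\mathcal{H}^N$ is the product Hilbert space with elements $\mathbf{x}=(x_1,\dots,x_N)$. Operators on $\mathcal{H}^N$: $A(\mathbf{x})=A_1(x_1)\times\dots\times A_N(x_N)$, $B(\mathbf{x})=(B_1(x_1),\dots,B_N(x_N))$. A real $N\times N$ matrix $M$ acts on $\mathcal{H}^N$ as $M\otimes I$ (Kronecker product with the identity of $\mathcal{H}$), and norms/definiteness of $M$ refer to this (equivalently to $M$ itself). $J_{T}=(I+T)^{-1}$ is the resolvent, so $J_{\Lambda A}=(I+\Lambda A)^{-1}$. Given a connected graph $(\mathcal{V},\mathcal{E})$ with $\mathcal{V}=\{1,\dots,N\}$, a matrix $W=(w_{ij})\in\mathbb{R}^{N\times N}$ is a mixing matrix if: $w_{ij}=0$ whenever $i\ne j$ and $(i,j)\notin\mathcal{E}$; $W=W^\top$; $\ker(I-W)=\mathbb{R}\mathbf{1}$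 where $\mathbf{1}=(1,\dots,1)^\top$; and $-I\prec W\preceq I$ in the Loewner order. *)

theory Defs
  imports "HOL-Analysis.Analysis"
begin

text \<open>Weak convergence in a real inner product space.\<close>
definition weak_conv :: "(nat \<Rightarrow> 'a::real_inner) \<Rightarrow> 'a \<Rightarrow> bool" where
  "weak_conv x l \<longleftrightarrow> (\<forall>u. (\<lambda>k. inner (x k) u) \<longlonglongrightarrow> inner l u)"

text \<open>Set-valued operators are functions into sets.\<close>
definition monotone_op :: "('a::real_inner \<Rightarrow> 'a set) \<Rightarrow> bool" where
  "monotone_op A \<longleftrightarrow>
     (\<forall>x y u v. u \<in> A x \<longrightarrow> v \<in> A y \<longrightarrow> inner (x - y) (u - v) \<ge> 0)"

definition maximal_monotone :: "('a::real_inner \<Rightarrow> 'a set) \<Rightarrow> bool" where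
  "maximal_monotone A \<longleftrightarrow> monotone_op A \<and>
     (\<forall>A'. monotone_op A' \<longrightarrow> (\<forall>x. A x \<subseteq> A' x) \<longrightarrow> A' = A)"

definition monotone_fun :: "('a::real_inner \<Rightarrow> 'a) \<Rightarrow> bool" where
  "monotone_fun B \<longleftrightarrow> (\<forall>x y. inner (x - y) (B x - B y) \<ge> 0)"

text \<open>Resolvent \<open>J_T = (I + T)^{-1}\<close>: the point \<open>x\<close> with \<open>z \<in> x + T x\<close>.\<close>
definition resolvent :: "('a::real_inner \<Rightarrow> 'a set) \<Rightarrow> 'a \<Rightarrow> 'a" where
  "resolvent T z = (THE x. z - x \<in> T x)"

text \<open>Product-space operators on \<open>\<H>^N\<close>, modelled as \<open>'a ^ 'n\<close>.\<close>
definition diag_op :: "('n::finite \<Rightarrow> real) \<Rightarrow> ('n \<Rightarrow> 'a::real_inner \<Rightarrow> 'a set)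
     \<Rightarrow> 'a ^ 'n \<Rightarrow> ('a ^ 'n) set" where
  "diag_op \<alpha> A x = {u. \<forall>i. u $ i \<in> (\<lambda>w. \<alpha> i *\<^sub>R w) ` A i (x $ i)}"
  \<comment> \<open>the operator \<open>\<Lambda>A\<close>, with \<open>\<Lambda> = diag(\<alpha>)\<close> and \<open>A = A_1 \<times> \<dots> \<times> A_N\<close>\<close>

definition prod_fun :: "('n::finite \<Rightarrow> 'a \<Rightarrow> 'a) \<Rightarrow> 'a ^ 'n \<Rightarrow> 'a ^ 'n" where
  "prod_fun B x = (\<chi> i. B i (x $ i))"

text \<open>A real matrix \<open>M\<close> acting on \<open>\<H>^N\<close> as \<open>M \<otimes> I\<close>.\<close>
definition mat_act :: "real ^ 'n ^ 'n \<Rightarrow> ('a::real_vector) ^ 'n \<Rightarrow> 'a ^ 'n::finite" where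
  "mat_act M x = (\<chi> i. \<Sum>j\<in>UNIV. (M $ i $ j) *\<^sub>R (x $ j))"

definition diag_mat :: "('n::finite \<Rightarrow> real) \<Rightarrow> real ^ 'n ^ 'n" where
  "diag_mat d = (\<chi> i j. if i = j then d i else 0)"

text \<open>Mixing matrix for a connected (undirected) graph with vertex set \<open>UNIV :: 'n set\<close>.\<close>
definition connected_graph :: "('n \<times> 'n) set \<Rightarrow> bool" where
  "connected_graph E \<longleftrightarrow> sym E \<and> (\<forall>i j. (i, j) \<in> E\<^sup>*)"

definition mixing_matrix :: "('n::finite \<times> 'n) set \<Rightarrow> real ^ 'n ^ 'n \<Rightarrow> bool" where
  "mixing_matrix E W \<longleftrightarrow>
     (\<forall>i j. i \<noteq> j \<and> (i, j) \<notin> E \<longrightarrow> W $ i $ j = 0) \<and>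
     transpose W = W \<and>
     {x. (mat 1 - W) *v x = 0} = range (\<lambda>c. c *\<^sub>R (1 :: real ^ 'n)) \<and>
     (\<forall>x. x \<noteq> 0 \<longrightarrow> - inner x x < inner x (W *v x)) \<and>
     (\<forall>x. inner x (W *v x) \<le> inner x x)"

text \<open>Zeros of \<open>\<Sum>_i (A_i + B_i)\<close>.\<close>
definition zeros_sum :: "('n::finite \<Rightarrow> 'a::real_inner \<Rightarrow> 'a set) \<Rightarrow> ('n \<Rightarrow> 'a \<Rightarrow> 'a) \<Rightarrow> 'a set" where
  "zeros_sum A B = {x. \<exists>u. (\<forall>i. u i \<in> A i x) \<and> (\<Sum>i\<in>UNIV. u i + B i x) = 0}"

end

theory Submission
  imports Defs
begin

text \<open>
  Conjugation by \<open>\<Lambda>\<^bsup>1/2\<^esup>\<close> turns the method into one with unit step sizes, with \<open>B\<close> Lipschitz of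
  constant \<open>L < 1/8\<close> and with the positive semidefinite \<open>M = \<Lambda>\<^bsup>1/2\<^esup> ((I - W)/2) \<Lambda>\<^bsup>1/2\<^esup>\<close>. A dual sequence \<open>q\<close> with
  \<open>z\<^bsub>k+1\<^esub> = x\<^bsub>k\<^esub> - v\<^bsub>k\<^esub> - M q\<^bsub>k\<^esub>\<close> makes it a primal-dual iteration for \<open>a + B p + M r = 0\<close>, \<open>M p = 0\<close>,
  \<open>a \<in> A p\<close>. The bound on \<open>\<beta>\<close> makes \<open>R = M/\<beta> - M\<^sup>2\<close> positive semidefinite, and
  \<open>\<parallel>z - (p + a)\<parallel>\<^sup>2 + \<parallel>q - r\<parallel>\<^sub>R\<^sup>2\<close>, corrected by the forward-reflected term
  \<open>-2 \<langle>B y\<^bsub>k\<^esub> - B y\<^bsub>k-1\<^esub>, y\<^bsub>k\<^esub> - p\<rangle>\<close> and by multiples of \<open>\<parallel>z\<^bsub>k\<^esub> - z\<^bsub>k-1\<^esub>\<parallel>\<^sup>2\<close> and \<open>\<parallel>z\<^bsub>k-1\<^esub> - z\<^bsub>k-2\<^esub>\<parallel>\<^sup>2\<close>,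
  decreases. Hence increments vanish, weak cluster points are solutions, and Opial's argument applies.
  Resolvents are total by Minty's theorem. Weak compactness is that of bounded sets in the product
  topology on functionals, so cluster points are taken along filters instead of subsequences.
\<close>

section \<open>Convex minimization, the Riesz representation and Minty's theorem\<close>

text \<open>A minimizing sequence for \<open>t + |x|^2 / 2\<close> has Cauchy
  \<open>x\<close>-components by the parallelogram identity at midpoints; the
  \<open>t\<close>-components then follow from the converging values. The conclusion is the
  first-order optimality condition, used below for a graph (Riesz) and an epigraph (Minty).\<close>

lemma closed_convex_quadratic_minimum:
  fixes C :: "('h::{real_inner, complete_space} \<times> real) set"
  assumes C: "closed C" "convex C" "C \<noteq> {}"
    and bdd: "\<And>x t. (x, t) \<in> C \<Longrightarrow> m \<le> t + (norm x)\<^sup>2 / 2"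
  obtains x\<^sub>0 t\<^sub>0 where "(x\<^sub>0, t\<^sub>0) \<in> C"
    "\<And>x t. (x, t) \<in> C \<Longrightarrow> t\<^sub>0 - inner x\<^sub>0 (x - x\<^sub>0) \<le> t"
proof -
  define J where "J p = snd p + (norm (fst p))\<^sup>2 / 2" for p :: "'h \<times> real"
  define I where "I = Inf (J ` C)"
  have bb: "bdd_below (J ` C)"
    using bdd by (intro bdd_belowI[of _ m]) (auto simp: J_def)
  have I_le: "I \<le> J p" if "p \<in> C" for p
    unfolding I_def using bb that by (intro cInf_lower) auto
  have "\<exists>p\<in>C. J p < I + 1 / real (Suc n)" for n
  proof (rule ccontr)
    assume "\<not> ?thesis"
    then have "\<And>p. p \<in> C \<Longrightarrow> I + 1 / real (Suc n) \<le> J p"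
      by (meson not_le)
    then have "I + 1 / real (Suc n) \<le> I"
      using C(3) unfolding I_def[symmetric] by (subst (2) I_def) (auto intro!: cInf_greatest)
    then show False by simp
  qed
  then obtain p where pC: "\<And>n. p n \<in> C" and pI: "\<And>n. J (p n) < I + 1 / real (Suc n)"
    by metis
  have near: "(norm (fst (p n) - fst (p k)))\<^sup>2 \<le> 4 * (1 / real (Suc n) + 1 / real (Suc k))" for n k
  proof -
    have "(1/2) *\<^sub>R p n + (1/2) *\<^sub>R p k \<in> C"
      using convexD[OF C(2) pC pC] by simp
    then have "I \<le> J ((1/2) *\<^sub>R p n + (1/2) *\<^sub>R p k)" by (rule I_le)
    also have "\<dots> = J (p n) / 2 + J (p k) / 2 - (norm (fst (p n) - fst (p k)))\<^sup>2 / 8"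
      by (simp add: J_def power2_norm_eq_inner inner_simps inner_commute field_simps)
    finally show ?thesis using pI[of n] pI[of k] by argo
  qed
  have "Cauchy (\<lambda>n. fst (p n))"
  proof (rule CauchyI)
    fix e :: real assume "0 < e"
    then obtain N where N: "8 / e\<^sup>2 < real N"
      using reals_Archimedean2 by blast
    have "norm (fst (p n) - fst (p k)) < e" if "N \<le> n" "N \<le> k" for n k
    proof -
      have N0: "0 < real N" using N \<open>0 < e\<close> by (smt (verit) divide_pos_pos zero_less_power)
      have "1 / real (Suc n) \<le> 1 / real N" "1 / real (Suc k) \<le> 1 / real N"
        using that N0 by (auto simp: field_simps)
      then have "(norm (fst (p n) - fst (p k)))\<^sup>2 \<le> 8 / real N"
        using near[of n k] by argo
      also have "\<dots> < e\<^sup>2"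
        using N N0 \<open>0 < e\<close> by (simp add: field_simps)
      finally show ?thesis using \<open>0 < e\<close> by (simp add: power2_less_imp_less)
    qed
    then show "\<exists>N. \<forall>n\<ge>N. \<forall>k\<ge>N. norm (fst (p n) - fst (p k)) < e" by blast
  qed
  then obtain x0 where x0: "(\<lambda>n. fst (p n)) \<longlonglongrightarrow> x0"
    using Cauchy_convergent convergent_def by blast
  have "(\<lambda>n. I + 1 / real (Suc n)) \<longlonglongrightarrow> I + 0"
    by (intro tendsto_add tendsto_const LIMSEQ_Suc[OF lim_1_over_n])
  then have "(\<lambda>n. J (p n)) \<longlonglongrightarrow> I"
    using tendsto_sandwich[of "\<lambda>n. I" "\<lambda>n. J (p n)" sequentially "\<lambda>n. I + 1 / real (Suc n)" I]
      I_le[OF pC] less_imp_le[OF pI] by simp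
  then have "(\<lambda>n. J (p n) - (norm (fst (p n)))\<^sup>2 / 2) \<longlonglongrightarrow> I - (norm x0)\<^sup>2 / 2"
    by (intro tendsto_intros x0) simp_all
  then have t0: "(\<lambda>n. snd (p n)) \<longlonglongrightarrow> I - (norm x0)\<^sup>2 / 2"
    by (simp add: J_def)
  define t0 where "t0 = I - (norm x0)\<^sup>2 / 2"
  have "(\<lambda>n. (fst (p n), snd (p n))) \<longlonglongrightarrow> (x0, t0)"
    using x0 t0 unfolding t0_def by (rule tendsto_Pair)
  then have in0: "(x0, t0) \<in> C"
    using C(1) pC by (auto intro: closed_sequentially)
  have "t0 - inner x0 (x - x0) \<le> t" if xt: "(x, t) \<in> C" for x t
  proof (rule ccontr)
    define g where "g = t - t0 + inner x0 (x - x0)"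
    assume "\<not> ?thesis"
    then have g: "g < 0" by (simp add: g_def)
    \<comment> \<open>On the segment from the minimizer the objective exceeds \<open>I\<close> by
      \<open>l\<close> times this expression, so one may divide by \<open>l\<close> and let it tend
      to 0.\<close>
    have key: "0 \<le> g + l / 2 * (norm (x - x0))\<^sup>2" if l: "0 < l" "l \<le> 1" for l :: real
    proof -
      have "(1 - l) *\<^sub>R (x0, t0) + l *\<^sub>R (x, t) \<in> C"
        using convexD[OF C(2) in0 xt, of "1 - l" l] l by simp
      then have "I \<le> J ((1 - l) *\<^sub>R (x0, t0) + l *\<^sub>R (x, t))" by (rule I_le)
      also have "\<dots> = I + l * (g + l / 2 * (norm (x - x0))\<^sup>2)"
        by (simp add: J_def g_def t0_def power2_norm_eq_inner inner_simps inner_commute)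
           (simp add: algebra_simps power2_eq_square add_divide_distrib diff_divide_distrib)
      finally show ?thesis using l by (simp add: zero_le_mult_iff)
    qed
    have "((\<lambda>l. g + l / 2 * (norm (x - x0))\<^sup>2) \<longlongrightarrow> g + 0 / 2 * (norm (x - x0))\<^sup>2) (at_right 0)"
      by (intro tendsto_intros) auto
    moreover have "eventually (\<lambda>l. 0 \<le> g + l / 2 * (norm (x - x0))\<^sup>2) (at_right (0::real))"
      using eventually_at_right_real[of 0 "1::real"]
      by (rule eventually_mono) (use key in auto)
    ultimately have "0 \<le> g"
      by (intro tendsto_lowerbound[of _ g "at_right 0"]) auto
    with g show False by simp
  qed
  with in0 show ?thesis by (rule that)
qed

text \<open>The graph of \<open>f\<close> is a linear subspace, so the optimality inequality of a
  minimizer over it holds for both \<open>u\<close> and \<open>- u\<close>, hence with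
  equality.\<close>

lemma riesz_representation:
  fixes f :: "'h::{real_inner, complete_space} \<Rightarrow> real"
  assumes "bounded_linear f"
  obtains l where "\<And>x. f x = inner l x"
proof -
  interpret f: bounded_linear f by fact
  obtain K where K: "\<And>x. norm (f x) \<le> norm x * K" using f.bounded by blast
  define C where "C = range (\<lambda>x. (x, f x))"
  have "C = {p. snd p - f (fst p) = 0}" by (auto simp: C_def image_def)
  also have "closed \<dots>"
    by (intro closed_Collect_eq continuous_intros f.continuous_on)
  finally have "closed C" .
  moreover have "convex C"
    by (auto simp: C_def convex_def f.add f.scaleR image_iff)
  \<comment> \<open>Completes the square in \<open>norm x - K\<close>.\<close>
  moreover have "- K\<^sup>2 / 2 \<le> t + (norm x)\<^sup>2 / 2" if "(x, t) \<in> C" for x t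
    using that K[of x] zero_le_power2[of "norm x - K"]
    by (auto simp: C_def power2_diff abs_le_iff algebra_simps)
  ultimately obtain x0 t0 where 0: "(x0, t0) \<in> C"
      "\<And>x t. (x, t) \<in> C \<Longrightarrow> t0 - inner x0 (x - x0) \<le> t"
    using closed_convex_quadratic_minimum[of C "- K\<^sup>2 / 2"] unfolding C_def by blast
  have ge: "- inner x0 u \<le> f u" for u
  proof -
    have "t0 = f x0" "(x0 + u, f (x0 + u)) \<in> C" using 0(1) by (auto simp: C_def)
    with 0(2) show ?thesis by (fastforce simp: f.add)
  qed
  have "f u = inner (- x0) u" for u
    using ge[of u] ge[of "- u"] by (simp add: f.neg)
  then show ?thesis by (rule that)
qed

section \<open>Maximal monotone operators and Minty's surjectivity theorem\<close>

lemma maximal_monotone_related: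
  assumes "maximal_monotone A" "\<And>w c. c \<in> A w \<Longrightarrow> 0 \<le> inner (x - w) (u - c)"
  shows "u \<in> A x"
proof -
  \<comment> \<open>Adjoining the pair \<open>(x, u)\<close> to the graph keeps it monotone, so by
    maximality the pair was already there.\<close>
  define A' where "A' w = (if w = x then insert u (A x) else A w)" for w
  have mono: "0 \<le> inner (p - q) (c - d)" if "c \<in> A p" "d \<in> A q" for p q c d
    using assms(1) that unfolding maximal_monotone_def monotone_op_def by blast
  have sym: "0 \<le> inner (w - x) (c - u)" if "c \<in> A w" for w c
    using assms(2)[OF that] by (metis inner_minus_left inner_minus_right minus_diff_eq)
  have "monotone_op A'"
    unfolding monotone_op_def A'_def using mono assms(2) sym by (auto split: if_splits)
  moreover have "\<forall>w. A w \<subseteq> A' w" by (auto simp: A'_def)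
  ultimately have "A' = A" using assms(1) unfolding maximal_monotone_def by blast
  then have "A x = insert u (A x)" by (metis A'_def)
  then show ?thesis by blast
qed

text \<open>The set \<open>C\<close> is the epigraph of the Fitzpatrick function.
  A minimizer \<open>(x\<^sub>0, u\<^sub>0, t\<^sub>0)\<close> of \<open>t + (|x|\<^sup>2 + |u|\<^sup>2) / 2\<close> over it makes \<open>(- u\<^sub>0, - x\<^sub>0)\<close> monotonically
  related to \<open>A\<close>, and testing with this very pair forces \<open>u\<^sub>0 = - x\<^sub>0\<close>.\<close>
lemma minty_zero:
  fixes A :: "'h::{real_inner, complete_space} \<Rightarrow> 'h set"
  assumes related: "\<And>x u. (\<And>w c. c \<in> A w \<Longrightarrow> 0 \<le> inner (x - w) (u - c)) \<Longrightarrow> u \<in> A x"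
    and mono: "monotone_op A"
  shows "\<exists>x. - x \<in> A x"
proof -
  define C :: "(('h \<times> 'h) \<times> real) set" where
    "C = {p. \<forall>w c. c \<in> A w \<longrightarrow> inner (fst (fst p)) c + inner w (snd (fst p)) - inner w c \<le> snd p}"
  have "C = (\<Inter>w. \<Inter>c\<in>A w. {p. inner (fst (fst p)) c + inner w (snd (fst p)) - inner w c \<le> snd p})"
    by (auto simp: C_def)
  also have "closed \<dots>"
    by (intro closed_INT ballI closed_Collect_le continuous_intros)
  finally have "closed C" .
  moreover have "convex C"
  proof (rule convexI)
    fix p q :: "('h \<times> 'h) \<times> real" and s t :: real
    assume "p \<in> C" "q \<in> C" and st: "0 \<le> s" "0 \<le> t" "s + t = 1"
    show "s *\<^sub>R p + t *\<^sub>R q \<in> C"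
      unfolding C_def
    proof (intro CollectI allI impI)
      fix w c assume c: "c \<in> A w"
      let ?h = "\<lambda>p::('h \<times> 'h) \<times> real. inner (fst (fst p)) c + inner w (snd (fst p)) - inner w c"
      have "?h (s *\<^sub>R p + t *\<^sub>R q) = s * ?h p + t * ?h q - (1 - (s + t)) * inner w c"
        by (simp add: inner_simps algebra_simps)
      also have "\<dots> \<le> s * snd p + t * snd q"
        using \<open>p \<in> C\<close> \<open>q \<in> C\<close> c st unfolding C_def
        by (simp add: add_mono mult_left_mono)
      finally show "?h (s *\<^sub>R p + t *\<^sub>R q) \<le> snd (s *\<^sub>R p + t *\<^sub>R q)" by simp
    qed
  qed
  moreover have inC: "((w, c), inner w c) \<in> C" if "c \<in> A w" for w c
    unfolding C_def
  proof (intro CollectI allI impI)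
    fix w' c' assume "c' \<in> A w'"
    with mono that have "0 \<le> inner (w - w') (c - c')"
      unfolding monotone_op_def by blast
    then show "inner (fst (fst ((w, c), inner w c))) c' + inner w' (snd (fst ((w, c), inner w c)))
        - inner w' c' \<le> snd ((w, c), inner w c)"
      by (simp add: inner_diff_left inner_diff_right)
  qed
  \<comment> \<open>If the graph were empty, the premise of \<open>related\<close> would hold
    vacuously at \<open>(0, 0)\<close> and put that pair into it.\<close>
  moreover have "\<exists>w c. c \<in> A w"
    using related[of 0 0] by blast
  \<comment> \<open>The Fitzpatrick function dominates the pairing: if \<open>t < inner x u\<close>,
    then \<open>(x, u)\<close> is related to the whole graph, hence belongs to it and may be tested
    against itself.\<close>
  moreover have ge: "inner x u \<le> t" if "((x, u), t) \<in> C" for x u t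
  proof (rule ccontr)
    assume less: "\<not> inner x u \<le> t"
    have h: "inner x c + inner w u - inner w c \<le> t" if "c \<in> A w" for w c
      using \<open>((x, u), t) \<in> C\<close> that by (auto simp: C_def)
    have "u \<in> A x"
    proof (rule related)
      fix w c assume "c \<in> A w"
      from h[OF this] less show "0 \<le> inner (x - w) (u - c)"
        by (simp add: inner_simps inner_commute algebra_simps)
    qed
    from h[OF this] less show False by simp
  qed
  moreover have "0 \<le> t + (norm p)\<^sup>2 / 2" if "(p, t) \<in> C" for p t
  proof -
    have "0 \<le> (norm (fst p + snd p))\<^sup>2 / 2" by simp
    also have "\<dots> = inner (fst p) (snd p) + (norm p)\<^sup>2 / 2"
      by (simp add: power2_norm_eq_inner inner_prod_def inner_simps inner_commute field_simps)
    also have "\<dots> \<le> t + (norm p)\<^sup>2 / 2"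
      using ge[of "fst p" "snd p" t] that by simp
    finally show ?thesis .
  qed
  ultimately obtain p0 t0 where 0: "(p0, t0) \<in> C"
      "\<And>p t. (p, t) \<in> C \<Longrightarrow> t0 - inner p0 (p - p0) \<le> t"
    using closed_convex_quadratic_minimum[of C 0] by blast
  obtain x0 u0 where p0: "p0 = (x0, u0)" by force
  \<comment> \<open>Optimality at the graph point \<open>((w, c), inner w c)\<close>, with
    \<open>t0\<close> bounded below by \<open>inner x0 u0\<close>, completes the square.\<close>
  have *: "(norm (x0 + u0))\<^sup>2 \<le> inner (w + u0) (c + x0)" if "c \<in> A w" for w c
    using 0(2)[OF inC[OF that]] ge[of x0 u0 t0] 0(1) unfolding p0
    by (simp add: power2_norm_eq_inner inner_simps inner_commute algebra_simps)
  have "- x0 \<in> A (- u0)"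
  proof (rule related)
    fix w c assume "c \<in> A w"
    then have "0 \<le> inner (w + u0) (c + x0)" using * by (meson order_trans zero_le_power2)
    then show "0 \<le> inner (- u0 - w) (- x0 - c)"
      by (simp add: inner_simps algebra_simps)
  qed
  moreover from *[OF this] have "- u0 = x0"
    by (simp add: add.commute eq_neg_iff_add_eq_0 neg_eq_iff_add_eq_0)
  ultimately show ?thesis by auto
qed

lemma minty:
  fixes A :: "'h::{real_inner, complete_space} \<Rightarrow> 'h set"
  assumes A: "maximal_monotone A" and a: "0 < a"
  shows "\<exists>x. z - x \<in> (\<lambda>w. a *\<^sub>R w) ` A x"
proof -
  \<comment> \<open>\<open>T\<close> is \<open>a A - z\<close>, so \<open>- x \<in> T x\<close>
    reads \<open>z - x \<in> a A x\<close>.\<close>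
  define T where "T x = {u. (u + z) /\<^sub>R a \<in> A x}" for x
  have "\<exists>x. - x \<in> T x"
  proof (rule minty_zero)
    show "monotone_op T"
      unfolding monotone_op_def
    proof (intro allI impI)
      fix x y u v assume "u \<in> T x" "v \<in> T y"
      then have "0 \<le> inner (x - y) ((u + z) /\<^sub>R a - (v + z) /\<^sub>R a)"
        using A unfolding maximal_monotone_def monotone_op_def T_def by blast
      also have "(u + z) /\<^sub>R a - (v + z) /\<^sub>R a = (u - v) /\<^sub>R a"
        by (simp add: algebra_simps)
      finally show "0 \<le> inner (x - y) (u - v)"
        using a by (simp add: zero_le_mult_iff zero_le_divide_iff)
    qed
  next
    fix x u assume rel: "\<And>w c. c \<in> T w \<Longrightarrow> 0 \<le> inner (x - w) (u - c)"
    have "(u + z) /\<^sub>R a \<in> A x"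
    proof (rule maximal_monotone_related[OF A])
      fix w c assume "c \<in> A w"
      then have "a *\<^sub>R c - z \<in> T w" using a by (simp add: T_def)
      from rel[OF this] have "0 \<le> inner (x - w) (u + z - a *\<^sub>R c)" by (simp add: algebra_simps)
      also have "u + z - a *\<^sub>R c = a *\<^sub>R ((u + z) /\<^sub>R a - c)"
        using a by (simp add: algebra_simps)
      finally show "0 \<le> inner (x - w) ((u + z) /\<^sub>R a - c)"
        using a by (simp add: zero_le_mult_iff)
    qed
    then show "u \<in> T x" by (simp add: T_def)
  qed
  then obtain x where "(z - x) /\<^sub>R a \<in> A x" by (auto simp: T_def)
  then have "a *\<^sub>R ((z - x) /\<^sub>R a) \<in> (\<lambda>w. a *\<^sub>R w) ` A x" by (rule imageI)
  then show ?thesis using a by auto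
qed

lemma resolvent_eqI:
  assumes "monotone_op T" "z - x \<in> T x"
  shows "resolvent T z = x"
  unfolding resolvent_def
proof (rule the_equality)
  fix w assume "z - w \<in> T w"
  with assms have "0 \<le> inner (w - x) ((z - w) - (z - x))"
    unfolding monotone_op_def by blast
  then have "inner (w - x) (w - x) \<le> 0"
    by (simp add: inner_simps inner_commute algebra_simps)
  then show "w = x" using inner_ge_zero[of "w - x"] by simp
qed fact

section \<open>Weak cluster points along filters\<close>

text \<open>The functionals \<open>inner (X k)\<close> lie in a product of intervals, compact by
  Tychonoff. A cluster point \<open>f\<close> is a pointwise limit, hence linear and bounded, and
  Riesz turns it into a vector.\<close>

lemma weak_cluster_point:
  fixes X :: "nat \<Rightarrow> 'h::{real_inner, complete_space}"
  assumes F: "F \<noteq> bot" and bdd: "\<And>k. norm (X k) \<le> K"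
  obtains G l where "G \<noteq> bot" "G \<le> F" "\<And>u. ((\<lambda>k. inner (X k) u) \<longlongrightarrow> inner l u) G"
proof -
  define \<phi> where "\<phi> k u = inner (X k) u" for k u
  define C where "C = (\<Pi>\<^sub>E u\<in>(UNIV::'h set). {- (K * norm u)..K * norm u})"
  have bnd: "\<bar>inner (X k) u\<bar> \<le> K * norm u" for k u
    using Cauchy_Schwarz_ineq2[of "X k" u] mult_right_mono[OF bdd norm_ge_zero, of k u] by linarith
  have "compactin (product_topology (\<lambda>_. euclidean) UNIV) C"
    unfolding C_def by (auto simp: compactin_PiE)
  then have "compact C"
    by (simp add: euclidean_product_topology)
  moreover have "\<phi> k \<in> C" for k
    using bnd[of k] by (auto simp: C_def \<phi>_def abs_le_iff minus_le_iff)
  then have "eventually (\<lambda>f. f \<in> C) (filtermap \<phi> F)"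
    by (simp add: eventually_filtermap)
  moreover have "filtermap \<phi> F \<noteq> bot" using F by (simp add: filtermap_bot_iff)
  ultimately obtain f where f: "f \<in> C" "inf (nhds f) (filtermap \<phi> F) \<noteq> bot"
    unfolding compact_filter by blast
  \<comment> \<open>\<open>G\<close> refines \<open>F\<close> by the pullback of the neighbourhoods
    of \<open>f\<close>; it is proper because \<open>f\<close> is a cluster point of the image
    filter.\<close>
  define G where "G = inf (filtercomap \<phi> (nhds f)) F"
  have "G \<noteq> bot"
  proof
    assume "G = bot"
    then obtain P Q where PQ: "eventually P (filtercomap \<phi> (nhds f))" "eventually Q F"
        "\<And>k. P k \<Longrightarrow> Q k \<Longrightarrow> False"
      unfolding G_def trivial_limit_def eventually_inf by auto
    from PQ(1) obtain R where R: "eventually R (nhds f)" "\<And>k. R (\<phi> k) \<Longrightarrow> P k"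
      unfolding eventually_filtercomap by blast
    have "eventually (\<lambda>g. \<not> R g) (filtermap \<phi> F)"
      unfolding eventually_filtermap using PQ(2) by (rule eventually_mono) (use PQ(3) R(2) in blast)
    with R(1) have "eventually (\<lambda>g. False) (inf (nhds f) (filtermap \<phi> F))"
      unfolding eventually_inf by blast
    with f(2) show False by (simp add: trivial_limit_def)
  qed
  moreover have "G \<le> F" by (simp add: G_def)
  moreover have lim: "((\<lambda>k. inner (X k) u) \<longlongrightarrow> f u) G" for u
  proof -
    have "(\<phi> \<longlongrightarrow> f) G"
      unfolding G_def filterlim_def
      by (meson filtermap_filtercomap filtermap_mono inf_le1 order_trans)
    moreover have "continuous_on UNIV (\<lambda>g::'h \<Rightarrow> real. g u)"
      by (rule continuous_on_product_coordinates)
    ultimately have "((\<lambda>k. \<phi> k u) \<longlongrightarrow> f u) G"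
      using continuous_on_tendsto_compose[of UNIV "\<lambda>g. g u" \<phi> f G] by simp
    then show ?thesis by (simp add: \<phi>_def)
  qed
  moreover have "bounded_linear f"
  proof (rule bounded_linear_intro)
    show "f (u + w) = f u + f w" for u w
      using tendsto_unique[OF \<open>G \<noteq> bot\<close> lim[of "u + w"]] tendsto_add[OF lim[of u] lim[of w]]
      by (simp add: inner_add_right)
    show "f (r *\<^sub>R u) = r *\<^sub>R f u" for r u
      using tendsto_unique[OF \<open>G \<noteq> bot\<close> lim[of "r *\<^sub>R u"]] tendsto_mult_left[OF lim[of u], of r]
      by simp
    show "norm (f u) \<le> norm u * K" for u
      using f(1) by (auto simp: C_def PiE_iff abs_le_iff minus_le_iff mult.commute)
  qed
  then obtain l where "\<And>u. f u = inner l u" using riesz_representation by blast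
  ultimately show ?thesis using that by auto
qed

text \<open>For fixed \<open>w\<close>, Riesz writes \<open>inner (f u) w\<close> as
  \<open>inner g u\<close>, so \<open>g\<close> serves as the adjoint of \<open>f\<close> at
  \<open>w\<close>.\<close>

lemma bounded_linear_weak_limit:
  fixes f :: "'h::{real_inner, complete_space} \<Rightarrow> 'k::real_inner"
  assumes f: "bounded_linear f" and lim: "\<And>u. ((\<lambda>k. inner (X k) u) \<longlongrightarrow> inner l u) G"
  shows "((\<lambda>k. inner (f (X k)) w) \<longlongrightarrow> inner (f l) w) G"
proof -
  have "bounded_linear (\<lambda>u. inner (f u) w)"
    using f by (rule bounded_linear_compose[OF bounded_linear_inner_left])
  then obtain g where "\<And>u. inner (f u) w = inner g u" using riesz_representation by blast
  then show ?thesis using lim[of g] by (simp add: inner_commute)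
qed

text \<open>Filter version of the principle that a sequence converges if each subsequence has a
  further subsequence with that limit: staying at distance at least \<open>e\<close> would persist
  in every finer filter.\<close>

lemma tendsto_by_subfilters:
  fixes f :: "'i \<Rightarrow> 'b::metric_space"
  assumes "\<And>F. F \<noteq> bot \<Longrightarrow> F \<le> F\<^sub>0 \<Longrightarrow> \<exists>G. G \<noteq> bot \<and> G \<le> F \<and> (f \<longlongrightarrow> l) G"
  shows "(f \<longlongrightarrow> l) F\<^sub>0"
proof (rule tendstoI, rule ccontr)
  fix e :: real assume "0 < e" and not_ev: "\<not> eventually (\<lambda>k. dist (f k) l < e) F\<^sub>0"
  define F where "F = inf F\<^sub>0 (principal {k. \<not> dist (f k) l < e})"
  have "F \<noteq> bot"
    using not_ev by (auto simp: F_def trivial_limit_def eventually_inf_principal)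
  moreover have "F \<le> F\<^sub>0" by (simp add: F_def)
  ultimately obtain G where G: "G \<noteq> bot" "G \<le> F" "(f \<longlongrightarrow> l) G" using assms by blast
  have "eventually (\<lambda>k. \<not> dist (f k) l < e) F"
    by (simp add: F_def eventually_inf_principal)
  then have "eventually (\<lambda>k. \<not> dist (f k) l < e) G"
    using G(2) by (simp add: filter_leD)
  moreover have "eventually (\<lambda>k. dist (f k) l < e) G"
    using G(3) \<open>0 < e\<close> by (rule tendstoD)
  ultimately have "eventually (\<lambda>k. False) G" by eventually_elim simp
  with G(1) show False by (simp add: trivial_limit_def)
qed

section \<open>The iteration with unit step sizes\<close>

lemma inner_tendsto_zero:
  fixes f g :: "'i \<Rightarrow> 'h::real_inner"
  assumes "(f \<longlongrightarrow> 0) F" "\<And>k. norm (g k) \<le> K"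
  shows "((\<lambda>k. inner (f k) (g k)) \<longlongrightarrow> 0) F"
  using assms(1)
proof (rule tendsto_0_le)
  show "eventually (\<lambda>k. norm (inner (f k) (g k)) \<le> norm (f k) * K) F"
  proof (intro always_eventually allI)
    fix k
    show "norm (inner (f k) (g k)) \<le> norm (f k) * K"
      using order_trans[OF Cauchy_Schwarz_ineq2 mult_left_mono[OF assms(2) norm_ge_zero]] by simp
  qed
qed

text \<open>Minty's trick: testing at \<open>p\<close> displaced slightly against
  \<open>h = B p - b\<close> leaves only a negative multiple of the squared norm of
  \<open>h\<close>.\<close>

lemma lipschitz_related_imp_eq:
  fixes B :: "'h::real_inner \<Rightarrow> 'h"
  assumes lip: "\<And>u w. norm (B u - B w) \<le> L * norm (u - w)" and "0 \<le> L"
    and rel: "\<And>w. 0 \<le> inner (p - w) (b - B w)"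
  shows "b = B p"
proof -
  define h where "h = B p - b"
  \<comment> \<open>Any \<open>t > 0\<close> with \<open>t * L < 1\<close> works; the denominator
    \<open>L + 1\<close> also covers \<open>L = 0\<close>.\<close>
  define t where "t = 1 / (L + 1)"
  have t: "0 < t" "t * L < 1" using \<open>0 \<le> L\<close> by (auto simp: t_def field_simps)
  have "0 \<le> inner (t *\<^sub>R h) (b - B (p - t *\<^sub>R h))"
    using rel[of "p - t *\<^sub>R h"] by simp
  then have "0 \<le> inner h (b - B (p - t *\<^sub>R h))"
    using t by (simp add: zero_le_mult_iff)
  also have "\<dots> = inner h (B p - B (p - t *\<^sub>R h)) - (norm h)\<^sup>2"
    by (simp add: h_def power2_norm_eq_inner inner_diff_right)
  also have "inner h (B p - B (p - t *\<^sub>R h)) \<le> norm h * (L * norm (t *\<^sub>R h))"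
    using lip[of p "p - t *\<^sub>R h"]
    by (intro order_trans[OF norm_cauchy_schwarz] mult_left_mono) auto
  also have "norm h * (L * norm (t *\<^sub>R h)) - (norm h)\<^sup>2 = - ((1 - t * L) * (norm h)\<^sup>2)"
    using t by (simp add: power2_eq_square algebra_simps)
  finally have "(norm h)\<^sup>2 \<le> 0" using t by (simp add: mult_le_0_iff)
  then show ?thesis by (simp add: h_def)
qed

lemma tendsto_zero_of_norm_square:
  fixes f :: "nat \<Rightarrow> 'h::real_normed_vector"
  assumes "0 < c" "(\<lambda>k. c * (norm (f k))\<^sup>2) \<longlonglongrightarrow> 0"
  shows "f \<longlonglongrightarrow> 0"
proof -
  have "(\<lambda>k. inverse c * (c * (norm (f k))\<^sup>2)) \<longlonglongrightarrow> inverse c * 0"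
    using assms(2) by (rule tendsto_mult_left)
  then have "(\<lambda>k. (norm (f k))\<^sup>2) \<longlonglongrightarrow> 0"
    using \<open>0 < c\<close> by (simp add: mult.assoc[symmetric])
  then have "(\<lambda>k. sqrt ((norm (f k))\<^sup>2)) \<longlonglongrightarrow> sqrt 0"
    by (rule tendsto_real_sqrt)
  then show ?thesis by (simp add: tendsto_norm_zero_iff)
qed

text \<open>The method after rescaling. The reflected term needs two values of \<open>y\<close>, so
  \<open>z_Suc\<close> starts at index 2. The update of \<open>q\<close> is implicit, and
  \<open>q\<close> may drift along the kernel of \<open>M\<close>; the generalized inverse
  \<open>G\<close> recovers a bounded representative from \<open>M (q k)\<close>.\<close>

locale splitting_iteration =
  fixes A :: "'h::{real_inner, complete_space} \<Rightarrow> 'h set" and B M G :: "'h \<Rightarrow> 'h"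
    and L \<beta> \<mu> :: real and x y z q :: "nat \<Rightarrow> 'h"
  assumes A_mono: "monotone_op A"
    and A_range: "\<exists>p. w - p \<in> A p"
    and B_mono: "monotone_fun B"
    and B_lip: "norm (B u - B w) \<le> L * norm (u - w)"
    and L: "0 \<le> L" "8 * L < 1"
    and M_linear: "bounded_linear M"
    and M_sym: "inner (M u) w = inner u (M w)"
    and M_bound: "(norm (M u))\<^sup>2 \<le> \<mu> * inner u (M u)"
    and params: "0 < \<beta>" "0 < \<mu>" "\<beta> * \<mu> < 1"
    and G_linear: "bounded_linear G"
    and M_G_M: "M (G (M u)) = M u"
    and z_x: "z k - x k \<in> A (x k)"
    and y_Suc: "y (Suc k) = x k + z (Suc k) - z k"
    and z_Suc: "z (Suc (Suc k)) = x (Suc k) - (2 *\<^sub>R B (y (Suc k)) - B (y k)) - M (q (Suc k))"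
    and q_Suc: "q (Suc k) = q k + \<beta> *\<^sub>R (y (Suc (Suc k)) + M (q (Suc k) - q k))"
begin

section \<open>Saddle points and the metric of the dual sequence\<close>

definition "solution p a r \<longleftrightarrow> a \<in> A p \<and> M p = 0 \<and> a + B p + M r = 0"

text \<open>Under this form the increment of \<open>q\<close> depends on \<open>y\<close> alone
  (\<open>R_step\<close>). It is kept bilinear for the sake of polarization.\<close>

definition "R u w = inner u (M w) / \<beta> - inner (M u) (M w)"

interpretation M: bounded_linear M by (rule M_linear)
interpretation G: bounded_linear G by (rule G_linear)

lemma A_inner: "a \<in> A p \<Longrightarrow> b \<in> A w \<Longrightarrow> 0 \<le> inner (p - w) (a - b)"
  using A_mono unfolding monotone_op_def by blast

text \<open>Firm nonexpansiveness of the resolvent, whose values at \<open>p + a\<close> and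
  \<open>w + b\<close> are \<open>p\<close> and \<open>w\<close>: in the expanded square the cross
  term is nonnegative by monotonicity.\<close>

lemma A_norm_le:
  assumes "a \<in> A p" "b \<in> A w"
  shows "norm (p - w) \<le> norm (p + a - (w + b))" "norm (a - b) \<le> norm (p + a - (w + b))"
proof -
  have "(norm (p + a - (w + b)))\<^sup>2 = (norm (p - w))\<^sup>2 + (norm (a - b))\<^sup>2 + 2 * inner (p - w) (a - b)"
    by (simp add: power2_norm_eq_inner inner_simps inner_commute algebra_simps)
  then have "(norm (p - w))\<^sup>2 \<le> (norm (p + a - (w + b)))\<^sup>2"
      "(norm (a - b))\<^sup>2 \<le> (norm (p + a - (w + b)))\<^sup>2"
    using A_inner[OF assms] by (smt (verit) zero_le_power2)+
  then show "norm (p - w) \<le> norm (p + a - (w + b))" "norm (a - b) \<le> norm (p + a - (w + b))"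
    by (auto intro: power2_le_imp_le)
qed

lemma R_commute: "R u w = R w u"
  unfolding R_def by (metis M_sym inner_commute)

lemma R_diff: "R (u - w) s = R u s - R w s"
  by (simp add: R_def M.diff inner_diff_left diff_divide_distrib)

lemma R_diff_right: "R s (u - w) = R s u - R s w"
  by (simp add: R_def M.diff inner_diff_right diff_divide_distrib)

lemma R_polarization: "2 * R u (u - w) = R u u - R w w + R (u - w) (u - w)"
  by (simp add: R_diff R_diff_right R_commute[of w u])

text \<open>\<open>M_bound\<close> compares \<open>inner u (M u)\<close> with the squared norm of
  \<open>M u\<close>. With \<open>\<beta> * \<mu> < 1\<close>, the form \<open>R\<close> therefore
  controls a dual vector modulo the kernel of \<open>M\<close>.\<close>

lemma R_pos: "(1 / (\<beta> * \<mu>) - 1) * (norm (M u))\<^sup>2 \<le> R u u"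
proof -
  have "(norm (M u))\<^sup>2 / (\<beta> * \<mu>) \<le> \<mu> * inner u (M u) / (\<beta> * \<mu>)"
    using M_bound params by (intro divide_right_mono) auto
  also have "\<dots> = inner u (M u) / \<beta>" using params by simp
  finally show ?thesis
    by (simp add: R_def power2_norm_eq_inner algebra_simps)
qed

lemma R_coeff_pos: "0 < 1 / (\<beta> * \<mu>) - 1"
  using params by (simp add: field_simps)

lemma R_nonneg: "0 \<le> R u u"
  using R_pos[of u] R_coeff_pos by (meson less_imp_le mult_nonneg_nonneg order_trans zero_le_power2)

text \<open>Applying \<open>M\<close> to the implicit update \<open>d = \<beta> (y + M d)\<close>
  gives \<open>M d / \<beta> - M (M d) = M y\<close>; this is paired with \<open>u\<close>.\<close>

lemma R_step: "R u (q (Suc k) - q k) = inner u (M (y (Suc (Suc k))))"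
proof -
  define d where "d = q (Suc k) - q k"
  have "d = \<beta> *\<^sub>R (y (Suc (Suc k)) + M d)"
    unfolding d_def using q_Suc[of k] by (metis add_diff_cancel_left')
  then have "M d = M (\<beta> *\<^sub>R (y (Suc (Suc k)) + M d))" by (rule arg_cong)
  then have "M d = \<beta> *\<^sub>R (M (y (Suc (Suc k))) + M (M d))"
    by (simp add: M.add M.scaleR)
  then have "inner u (M d) = \<beta> * (inner u (M (y (Suc (Suc k)))) + inner u (M (M d)))"
    by (metis inner_add_right inner_scaleR_right)
  then show ?thesis using params by (simp add: R_def d_def[symmetric] M_sym field_simps)
qed

lemma M_y_eq:
  "M (y (Suc (Suc k))) = (1 / \<beta>) *\<^sub>R M (q (Suc k) - q k) - M (M (q (Suc k) - q k))"
proof (rule inner_commute[THEN trans, THEN vector_eq_ldot[THEN iffD1, OF allI]])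
  fix u
  show "inner (M (y (Suc (Suc k)))) u
      = inner u ((1 / \<beta>) *\<^sub>R M (q (Suc k) - q k) - M (M (q (Suc k) - q k)))"
    using R_step[of u k] by (simp add: R_def inner_diff_right M_sym inner_commute)
qed

text \<open>Expanding the squared distance leaves three inner products: one is nonnegative by
  monotonicity of \<open>A\<close>, one telescopes in the metric \<open>R\<close>, and the forward
  one telescopes up to a Lipschitz error.\<close>

lemma energy_step:
  assumes "solution p a r"
  shows "(norm (z (Suc (Suc k)) - (p + a)))\<^sup>2 + R (q (Suc k) - r) (q (Suc k) - r)
      - 2 * inner (B (y (Suc (Suc k))) - B (y (Suc k))) (y (Suc (Suc k)) - p)
      + (norm (z (Suc (Suc k)) - z (Suc k)))\<^sup>2 + R (q (Suc k) - q k) (q (Suc k) - q k)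
    \<le> (norm (z (Suc k) - (p + a)))\<^sup>2 + R (q k - r) (q k - r)
      - 2 * inner (B (y (Suc k)) - B (y k)) (y (Suc k) - p)
      + L * ((norm (y (Suc k) - y k))\<^sup>2 + (norm (y (Suc (Suc k)) - y (Suc k)))\<^sup>2)"
proof -
  define v where "v = 2 *\<^sub>R B (y (Suc k)) - B (y k)"
  define s where "s = M (q (Suc k))"
  define y2 where "y2 = y (Suc (Suc k))"
  have a: "a = - B p - M r" and Mp: "M p = 0" and aA: "a \<in> A p"
    using assms by (auto simp: solution_def add_eq_0_iff2 algebra_simps)
  have z2: "z (Suc (Suc k)) = x (Suc k) - v - s"
    using z_Suc[of k] by (simp add: v_def s_def)
  have y2_eq: "y2 = x (Suc k) + (x (Suc k) - v - s) - z (Suc k)"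
    using y_Suc[of "Suc k"] by (simp add: y2_def z2)
  have "(norm (z (Suc (Suc k)) - (p + a)))\<^sup>2 + (norm (z (Suc (Suc k)) - z (Suc k)))\<^sup>2
      + 2 * inner (v - B p) (y2 - p) + 2 * inner (s - M r) (y2 - p)
      + 2 * inner (x (Suc k) - p) (z (Suc k) - x (Suc k) - a)
      = (norm (z (Suc k) - (p + a)))\<^sup>2"
    unfolding z2 y2_eq a
    by (simp add: power2_norm_eq_inner inner_simps inner_commute algebra_simps)
  moreover have "0 \<le> inner (x (Suc k) - p) (z (Suc k) - x (Suc k) - a)"
    using A_inner[OF z_x aA] .
  moreover have "2 * inner (s - M r) (y2 - p)
      = R (q (Suc k) - r) (q (Suc k) - r) - R (q k - r) (q k - r)
        + R (q (Suc k) - q k) (q (Suc k) - q k)"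
  proof -
    \<comment> \<open>Symmetry moves \<open>M\<close> onto \<open>y2 - p\<close>, where
      \<open>M p = 0\<close> removes \<open>p\<close>.\<close>
    have "inner (s - M r) (y2 - p) = inner (q (Suc k) - r) (M y2)"
      by (simp add: s_def M.diff[symmetric] M_sym) (simp add: M.diff Mp)
    also have "\<dots> = R (q (Suc k) - r) (q (Suc k) - q k)"
      using R_step by (simp add: y2_def)
    finally show ?thesis
      using R_polarization[of "q (Suc k) - r" "q k - r"] by simp
  qed
  \<comment> \<open>Forward-reflected splitting: the first term is nonnegative, the second is the
    new correction, the third the old one, and only the last has to be estimated.\<close>
  moreover have "inner (v - B p) (y2 - p) = inner (B y2 - B p) (y2 - p)
      - inner (B y2 - B (y (Suc k))) (y2 - p) + inner (B (y (Suc k)) - B (y k)) (y (Suc k) - p)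
      + inner (B (y (Suc k)) - B (y k)) (y2 - y (Suc k))"
    by (simp add: v_def inner_simps algebra_simps)
  moreover have "0 \<le> inner (B y2 - B p) (y2 - p)"
    using B_mono unfolding monotone_fun_def by (metis inner_commute)
  moreover have "- (L * ((norm (y (Suc k) - y k))\<^sup>2 + (norm (y2 - y (Suc k)))\<^sup>2))
      \<le> 2 * inner (B (y (Suc k)) - B (y k)) (y2 - y (Suc k))"
  proof -
    let ?n = "norm (y (Suc k) - y k)" and ?m = "norm (y2 - y (Suc k))"
    have "\<bar>inner (B (y (Suc k)) - B (y k)) (y2 - y (Suc k))\<bar> \<le> L * ?n * ?m"
      by (rule order_trans[OF Cauchy_Schwarz_ineq2 mult_right_mono[OF B_lip]]) simp
    moreover have "L * (2 * ?n * ?m) \<le> L * (?n\<^sup>2 + ?m\<^sup>2)"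
      using L by (intro mult_left_mono sum_squares_bound) auto
    ultimately show ?thesis by (simp add: algebra_simps abs_le_iff)
  qed
  ultimately show ?thesis unfolding y2_def by argo
qed

text \<open>By \<open>y_Suc\<close> this vector is the difference of two consecutive values
  \<open>z - x\<close>, which lie in \<open>A x\<close>.\<close>

lemma y_minus_x: "norm (y (Suc k) - x (Suc k)) \<le> norm (z (Suc k) - z k)"
  using A_norm_le(2)[OF z_x[of "Suc k"] z_x[of k]] by (simp add: y_Suc algebra_simps)

text \<open>Converts the Lipschitz errors, measured by increments of \<open>y\<close>, into
  increments of \<open>z\<close>, which the energy inequality controls.\<close>

lemma y_increment:
  "(norm (y (Suc (Suc k)) - y (Suc k)))\<^sup>2
    \<le> 2 * (norm (z (Suc (Suc k)) - z (Suc k)))\<^sup>2 + 2 * (norm (z (Suc k) - z k))\<^sup>2"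
proof -
  let ?a = "norm (z (Suc (Suc k)) - z (Suc k))" and ?b = "norm (z (Suc k) - z k)"
  have "y (Suc (Suc k)) - y (Suc k) = (z (Suc (Suc k)) - z (Suc k)) - (y (Suc k) - x (Suc k))"
    using y_Suc[of "Suc k"] by simp
  then have "norm (y (Suc (Suc k)) - y (Suc k)) \<le> ?a + norm (y (Suc k) - x (Suc k))"
    by (metis norm_triangle_ineq4)
  with y_minus_x[of k] have "norm (y (Suc (Suc k)) - y (Suc k)) \<le> ?a + ?b" by simp
  then have "(norm (y (Suc (Suc k)) - y (Suc k)))\<^sup>2 \<le> (?a + ?b)\<^sup>2"
    by (intro power_mono) auto
  also have "\<dots> \<le> 2 * ?a\<^sup>2 + 2 * ?b\<^sup>2"
    using sum_squares_bound[of ?a ?b] by (simp add: power2_sum)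
  finally show ?thesis .
qed

section \<open>The Lyapunov function and its consequences\<close>

definition "distance p a r k
  = (norm (z (Suc (Suc k)) - (p + a)))\<^sup>2 + R (q (Suc k) - r) (q (Suc k) - r)"

text \<open>By \<open>y_increment\<close> the error in \<open>energy_step\<close> is at most
  \<open>L\<close> times 2, 4 and 2 times three consecutive squared increments of \<open>z\<close>,
  newest first. The weights \<open>6 * L\<close> and \<open>2 * L\<close> absorb them and leave
  \<open>1 - 8 * L\<close> of the newest. Starting at index 2 makes room for the earlier
  increments.\<close>

definition "lyapunov p a r k = distance p a r k
  - 2 * inner (B (y (Suc (Suc k))) - B (y (Suc k))) (y (Suc (Suc k)) - p)
  + 6 * L * (norm (z (Suc (Suc k)) - z (Suc k)))\<^sup>2 + 2 * L * (norm (z (Suc k) - z k))\<^sup>2"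

lemma lyapunov_decrease:
  assumes "solution p a r"
  shows "lyapunov p a r (Suc k) + (1 - 8 * L) * (norm (z (Suc (Suc (Suc k))) - z (Suc (Suc k))))\<^sup>2
      + R (q (Suc (Suc k)) - q (Suc k)) (q (Suc (Suc k)) - q (Suc k)) \<le> lyapunov p a r k"
  using energy_step[OF assms, of "Suc k"] mult_left_mono[OF y_increment[of "Suc k"] L(1)]
    mult_left_mono[OF y_increment[of k] L(1)]
  unfolding lyapunov_def distance_def by (simp add: algebra_simps)

text \<open>Only the correction has unknown sign. Young's inequality and
  \<open>?m \<le> 2 * e + d\<close> bound it by \<open>8 * L\<close> times the square of
  \<open>e\<close> plus terms covered by the two increment weights.\<close>

lemma lyapunov_lower:
  assumes "solution p a r"
  shows "(1 - 8 * L) * (norm (z (Suc (Suc k)) - (p + a)))\<^sup>2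
      + R (q (Suc k) - r) (q (Suc k) - r) \<le> lyapunov p a r k"
proof -
  define d where "d = norm (z (Suc (Suc k)) - z (Suc k))"
  define e where "e = norm (z (Suc (Suc k)) - (p + a))"
  let ?n = "norm (y (Suc (Suc k)) - y (Suc k))" and ?m = "norm (y (Suc (Suc k)) - p)"
  have aA: "a \<in> A p" using assms by (simp add: solution_def)
  have "norm (z (Suc k) - x (Suc k) - a) \<le> norm (z (Suc k) - (p + a))"
    using A_norm_le(2)[OF z_x aA] by simp
  also have "\<dots> \<le> e + d"
    using norm_triangle_ineq4[of "z (Suc (Suc k)) - (p + a)" "z (Suc (Suc k)) - z (Suc k)"]
    unfolding e_def d_def by (simp only: diff_diff_eq2 diff_add_eq diff_diff_eq) (simp add: algebra_simps)
  finally have "norm (z (Suc k) - x (Suc k) - a) \<le> e + d" .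
  moreover have "y (Suc (Suc k)) - p = (z (Suc (Suc k)) - (p + a)) - (z (Suc k) - x (Suc k) - a)"
    using y_Suc[of "Suc k"] by simp
  then have "?m \<le> e + norm (z (Suc k) - x (Suc k) - a)"
    unfolding e_def by (metis norm_triangle_ineq4)
  ultimately have "?m \<le> 2 * e + d" by simp
  then have "?m\<^sup>2 \<le> (2 * e + d)\<^sup>2" by (intro power_mono) auto
  also have "\<dots> \<le> 8 * e\<^sup>2 + 2 * d\<^sup>2"
    using zero_le_power2[of "2 * e - d"] by (simp add: power2_diff power2_sum algebra_simps)
  finally have m: "L * ?m\<^sup>2 \<le> L * (8 * e\<^sup>2 + 2 * d\<^sup>2)"
    using L by (intro mult_left_mono)
  have n: "L * ?n\<^sup>2 \<le> L * (2 * d\<^sup>2 + 2 * (norm (z (Suc k) - z k))\<^sup>2)"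
    unfolding d_def using L y_increment by (intro mult_left_mono)
  have "inner (B (y (Suc (Suc k))) - B (y (Suc k))) (y (Suc (Suc k)) - p) \<le> L * ?n * ?m"
    by (rule order_trans[OF norm_cauchy_schwarz mult_right_mono[OF B_lip]]) simp
  moreover have "L * (2 * ?n * ?m) \<le> L * (?n\<^sup>2 + ?m\<^sup>2)"
    using L by (intro mult_left_mono sum_squares_bound) auto
  moreover have "0 \<le> L * d\<^sup>2" using L by simp
  ultimately show ?thesis
    using m n unfolding lyapunov_def distance_def d_def[symmetric] e_def[symmetric]
    by (simp add: algebra_simps)
qed

text \<open>The Lyapunov values are nonnegative and decreasing, so their decrements tend to 0, and
  these dominate the squared increments. For \<open>q\<close> this reaches only \<open>M\<close> of
  the increment, through \<open>R_pos\<close>.\<close>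

lemma asymptotic:
  assumes "solution p a r"
  shows "convergent (lyapunov p a r)"
    and "(\<lambda>k. z (Suc k) - z k) \<longlonglongrightarrow> 0"
    and "(\<lambda>k. M (q (Suc k) - q k)) \<longlonglongrightarrow> 0"
proof -
  let ?V = "lyapunov p a r"
  let ?d = "\<lambda>k. (1 - 8 * L) * (norm (z (Suc (Suc (Suc k))) - z (Suc (Suc k))))\<^sup>2"
  let ?r = "\<lambda>k. R (q (Suc (Suc k)) - q (Suc k)) (q (Suc (Suc k)) - q (Suc k))"
  have d0: "0 \<le> ?d k" for k using L by simp
  have V0: "0 \<le> ?V k" for k
    using lyapunov_lower[OF assms, of k] R_nonneg[of "q (Suc k) - r"] L
    by (smt (verit) mult_nonneg_nonneg zero_le_power2)
  have dec: "?V (Suc k) + ?d k + ?r k \<le> ?V k" for k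
    by (rule lyapunov_decrease[OF assms])
  have "decseq ?V"
    by (intro decseq_SucI) (use dec d0 R_nonneg in \<open>smt (verit)\<close>)
  then obtain c where c: "?V \<longlonglongrightarrow> c"
    using V0 decseq_convergent[of ?V 0] by blast
  then show "convergent ?V" by (rule convergentI)
  have diff: "(\<lambda>k. ?V k - ?V (Suc k)) \<longlonglongrightarrow> 0"
    using tendsto_diff[OF c LIMSEQ_Suc[OF c]] by simp
  have "?d \<longlonglongrightarrow> 0"
    by (rule tendsto_sandwich[OF _ _ tendsto_const diff])
       (use dec d0 R_nonneg in \<open>auto intro!: always_eventually, smt (verit)\<close>)
  then have "(\<lambda>k. z (Suc (Suc (Suc k))) - z (Suc (Suc k))) \<longlonglongrightarrow> 0"
    by (rule tendsto_zero_of_norm_square[rotated]) (use L in simp)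
  then show "(\<lambda>k. z (Suc k) - z k) \<longlonglongrightarrow> 0"
    by (simp add: filterlim_sequentially_Suc[of "\<lambda>k. z (Suc k) - z k"]
        filterlim_sequentially_Suc[of "\<lambda>k. z (Suc (Suc k)) - z (Suc k)"])
  have r: "?r \<longlonglongrightarrow> 0"
    by (rule tendsto_sandwich[OF _ _ tendsto_const diff])
       (use dec d0 R_nonneg in \<open>auto intro!: always_eventually, smt (verit)\<close>)
  have "(\<lambda>k. (1 / (\<beta> * \<mu>) - 1) * (norm (M (q (Suc (Suc k)) - q (Suc k))))\<^sup>2) \<longlonglongrightarrow> 0"
    by (rule tendsto_sandwich[OF _ _ tendsto_const r])
       (use R_pos R_coeff_pos in \<open>auto intro!: always_eventually\<close>)
  then have "(\<lambda>k. M (q (Suc (Suc k)) - q (Suc k))) \<longlonglongrightarrow> 0"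
    by (rule tendsto_zero_of_norm_square[rotated]) (rule R_coeff_pos)
  then show "(\<lambda>k. M (q (Suc k) - q k)) \<longlonglongrightarrow> 0"
    by (simp add: filterlim_sequentially_Suc[of "\<lambda>k. M (q (Suc k) - q k)"])
qed

lemma bounded_iterates:
  assumes "solution p a r"
  shows "\<exists>K. \<forall>k. norm (z k) \<le> K \<and> norm (x k) \<le> K \<and> norm (y k) \<le> K
    \<and> norm (B (y k)) \<le> K \<and> norm (M (q k)) \<le> K"
proof -
  have V: "lyapunov p a r k \<le> lyapunov p a r 0" for k
  proof (induction k)
    case (Suc k)
    have "lyapunov p a r (Suc k) \<le> lyapunov p a r k"
      using lyapunov_decrease[OF assms, of k] R_nonneg[of "q (Suc (Suc k)) - q (Suc k)"] L
      by (smt (verit) mult_nonneg_nonneg zero_le_power2)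
    with Suc show ?case by simp
  qed simp
  \<comment> \<open>The Lyapunov bounds are used from index 2 on; finitely many earlier terms do not
    affect boundedness.\<close>
  have bdd_shift: "Bseq f" if "\<And>k. c * (norm (f (k + 2) - w))\<^sup>2 \<le> e" "0 < c"
    for f :: "nat \<Rightarrow> 'h" and c e w
  proof -
    have "norm (f (k + 2)) \<le> sqrt (e / c) + norm w" for k
    proof -
      have "(norm (f (k + 2) - w))\<^sup>2 \<le> e / c" using that by (simp add: field_simps)
      then have "norm (f (k + 2) - w) \<le> sqrt (e / c)" by (rule real_le_rsqrt)
      then show ?thesis using norm_triangle_sub[of "f (k + 2)" w] by simp
    qed
    then have "Bseq (\<lambda>k. f (k + 2))" by (rule BseqI')
    then show ?thesis by (rule Bseq_offset)
  qed
  have Bz: "Bseq z"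
  proof (rule bdd_shift)
    show "(1 - 8 * L) * (norm (z (k + 2) - (p + a)))\<^sup>2 \<le> lyapunov p a r 0" for k
      using lyapunov_lower[OF assms, of k] V[of k] R_nonneg[of "q (Suc k) - r"] by simp
  qed (use L in simp)
  have Bq: "Bseq (\<lambda>k. M (q k))"
  proof (rule bdd_shift)
    show "(1 / (\<beta> * \<mu>) - 1) * (norm (M (q (k + 2)) - M r))\<^sup>2 \<le> lyapunov p a r 0" for k
    proof -
      have "(1 / (\<beta> * \<mu>) - 1) * (norm (M (q (k + 2)) - M r))\<^sup>2 \<le> R (q (k + 2) - r) (q (k + 2) - r)"
        using R_pos[of "q (k + 2) - r"] by (simp add: M.diff)
      also have "\<dots> \<le> lyapunov p a r (Suc k)"
        using lyapunov_lower[OF assms, of "Suc k"] L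
        by (smt (verit) mult_nonneg_nonneg zero_le_power2 add_2_eq_Suc')
      finally show ?thesis using V[of "Suc k"] by simp
    qed
  qed (rule R_coeff_pos)
  obtain Kz where Kz: "\<And>k. norm (z k) \<le> Kz" using Bz by (auto simp: Bseq_def)
  obtain Kq where Kq: "\<And>k. norm (M (q k)) \<le> Kq" using Bq by (auto simp: Bseq_def)
  define Kx where "Kx = norm p + (Kz + norm (p + a))"
  have Kx: "norm (x k) \<le> Kx" for k
  proof -
    have "norm (x k - p) \<le> norm (z k - (p + a))"
      using A_norm_le(1)[OF z_x] assms by (fastforce simp: solution_def)
    then show ?thesis
      using norm_triangle_sub[of "x k" p] norm_triangle_ineq4[of "z k" "p + a"] Kz[of k]
      by (simp add: Kx_def)
  qed
  \<comment> \<open>\<open>y_Suc\<close> does not reach \<open>y 0\<close>, so it enters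
    separately.\<close>
  define Ky where "Ky = max (norm (y 0)) (Kx + Kz + Kz)"
  have Ky: "norm (y k) \<le> Ky" for k
  proof (cases k)
    case (Suc j)
    have "norm (y k) \<le> norm (x j) + norm (z k) + norm (z j)"
      unfolding Suc y_Suc by (meson add_mono norm_triangle_ineq norm_triangle_ineq4 order_refl order_trans)
    then show ?thesis using Kx[of j] Kz[of k] Kz[of j] by (simp add: Ky_def)
  qed (simp add: Ky_def)
  define Kb where "Kb = L * Ky + norm (B 0)"
  have Kb: "norm (B (y k)) \<le> Kb" for k
    using norm_triangle_sub[of "B (y k)" "B 0"] B_lip[of "y k" 0] mult_left_mono[OF Ky L(1), of k]
    by (simp add: Kb_def)
  show ?thesis
    by (rule exI[of _ "Max {Kz, Kq, Kx, Ky, Kb}"])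
       (use Kz Kq Kx Ky Kb in \<open>simp add: le_max_iff_disj\<close>)
qed

text \<open>All three reduce to increments of \<open>z\<close> and of \<open>M q\<close>; for
  \<open>M x\<close>, \<open>M_y_eq\<close> treats \<open>M y\<close>, and
  \<open>y (Suc (Suc k))\<close> differs from \<open>x (Suc k)\<close> by an increment of
  \<open>z\<close>.\<close>

lemma increments:
  assumes "solution p a r"
  shows "(\<lambda>k. y (Suc k) - x (Suc k)) \<longlonglongrightarrow> 0"
    and "(\<lambda>k. B (y (Suc k)) - B (y k)) \<longlonglongrightarrow> 0"
    and "(\<lambda>k. M (x (Suc k))) \<longlonglongrightarrow> 0"
proof -
  have dz: "(\<lambda>k. z (Suc k) - z k) \<longlonglongrightarrow> 0" by (rule asymptotic(2)[OF assms])
  show yx: "(\<lambda>k. y (Suc k) - x (Suc k)) \<longlonglongrightarrow> 0"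
    by (rule tendsto_0_le[OF dz, of _ 1]) (simp add: y_minus_x)
  have "(\<lambda>k. (z (Suc (Suc k)) - z (Suc k)) - (y (Suc k) - x (Suc k))) \<longlonglongrightarrow> 0 - 0"
    by (intro tendsto_diff yx LIMSEQ_Suc[OF dz])
  then have "(\<lambda>k. y (Suc (Suc k)) - y (Suc k)) \<longlonglongrightarrow> 0"
    by (simp add: y_Suc[of "Suc _"] algebra_simps)
  then have dy: "(\<lambda>k. y (Suc k) - y k) \<longlonglongrightarrow> 0"
    by (simp add: filterlim_sequentially_Suc[of "\<lambda>k. y (Suc k) - y k"])
  show "(\<lambda>k. B (y (Suc k)) - B (y k)) \<longlonglongrightarrow> 0"
    by (rule tendsto_0_le[OF dy, of _ L]) (simp add: B_lip mult.commute)
  have dq: "(\<lambda>k. M (q (Suc k) - q k)) \<longlonglongrightarrow> 0" by (rule asymptotic(3)[OF assms])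
  have "(\<lambda>k. (1 / \<beta>) *\<^sub>R M (q (Suc k) - q k) - M (M (q (Suc k) - q k))
      - M (z (Suc (Suc k)) - z (Suc k))) \<longlonglongrightarrow> (1 / \<beta>) *\<^sub>R 0 - M 0 - M 0"
    by (intro tendsto_intros dq M.tendsto LIMSEQ_Suc[OF dz])
  then show "(\<lambda>k. M (x (Suc k))) \<longlonglongrightarrow> 0"
    by (simp add: M_y_eq[symmetric] M.diff[symmetric] y_Suc[of "Suc _"] M.zero)
qed

text \<open>The corrections in \<open>lyapunov\<close> vanish in the limit, since the increments of
  \<open>B y\<close> tend to 0 and \<open>y\<close> is bounded.\<close>

lemma distance_convergent:
  assumes "solution p a r"
  shows "convergent (distance p a r)"
proof -
  obtain K where K: "\<And>k. norm (y k) \<le> K" using bounded_iterates[OF assms] by blast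
  have dz: "(\<lambda>k. z (Suc k) - z k) \<longlonglongrightarrow> 0" by (rule asymptotic(2)[OF assms])
  obtain c where c: "lyapunov p a r \<longlonglongrightarrow> c"
    using asymptotic(1)[OF assms] by (auto simp: convergent_def)
  have b: "(\<lambda>k. inner (B (y (Suc (Suc k))) - B (y (Suc k))) (y (Suc (Suc k)) - p)) \<longlonglongrightarrow> 0"
    by (rule inner_tendsto_zero[OF LIMSEQ_Suc[OF increments(2)[OF assms]], of _ "K + norm p"])
       (use norm_triangle_ineq4 K add_right_mono order_trans in blast)
  have "(\<lambda>k. lyapunov p a r k
      + 2 * inner (B (y (Suc (Suc k))) - B (y (Suc k))) (y (Suc (Suc k)) - p)
      - 6 * L * (norm (z (Suc (Suc k)) - z (Suc k)))\<^sup>2 - 2 * L * (norm (z (Suc k) - z k))\<^sup>2)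
    \<longlonglongrightarrow> c + 2 * 0 - 6 * L * (norm (0::'h))\<^sup>2 - 2 * L * (norm (0::'h))\<^sup>2"
    by (intro tendsto_intros c b dz LIMSEQ_Suc[OF dz])
  then show ?thesis by (auto simp: lyapunov_def intro: convergentI)
qed

section \<open>Weak cluster points and Opial's argument\<close>

definition "weak_cluster F p zb sb \<longleftrightarrow>
  (\<forall>u. ((\<lambda>k. inner (z (Suc k)) u) \<longlongrightarrow> inner zb u) F)
  \<and> (\<forall>u. ((\<lambda>k. inner (x (Suc k)) u) \<longlongrightarrow> inner p u) F)
  \<and> (\<forall>u. ((\<lambda>k. inner (M (q (Suc k))) u) \<longlongrightarrow> inner sb u) F)"

text \<open>The filter is refined three times, once per bounded sequence; on the dual side the
  bounded sequence is \<open>M q\<close>.\<close>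

lemma weak_cluster_exists:
  assumes sol: "solution p a r" and F: "F \<noteq> bot"
  obtains H pb zb sb where "H \<noteq> bot" "H \<le> F" "weak_cluster H pb zb sb"
proof -
  obtain K where K: "\<And>k. norm (z k) \<le> K" "\<And>k. norm (x k) \<le> K" "\<And>k. norm (M (q k)) \<le> K"
    using bounded_iterates[OF sol] by blast
  obtain H1 zb where 1: "H1 \<noteq> bot" "H1 \<le> F"
      "\<And>u. ((\<lambda>k. inner (z (Suc k)) u) \<longlongrightarrow> inner zb u) H1"
    using weak_cluster_point[OF F, of "\<lambda>k. z (Suc k)"] K(1) by blast
  obtain H2 pb where 2: "H2 \<noteq> bot" "H2 \<le> H1"
      "\<And>u. ((\<lambda>k. inner (x (Suc k)) u) \<longlongrightarrow> inner pb u) H2"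
    using weak_cluster_point[OF 1(1), of "\<lambda>k. x (Suc k)"] K(2) by blast
  obtain H3 sb where 3: "H3 \<noteq> bot" "H3 \<le> H2"
      "\<And>u. ((\<lambda>k. inner (M (q (Suc k))) u) \<longlongrightarrow> inner sb u) H3"
    using weak_cluster_point[OF 2(1), of "\<lambda>k. M (q (Suc k))"] K(3) by blast
  have "weak_cluster H3 pb zb sb"
    unfolding weak_cluster_def
    using 1(3) 2(3) 3(3) tendsto_mono[OF 3(2)] tendsto_mono[OF order_trans[OF 3(2) 2(2)]] by blast
  with 3(1) order_trans[OF 3(2) order_trans[OF 2(2) 1(2)]] show ?thesis by (rule that)
qed

text \<open>Inner products of weakly convergent sequences need not pass to the limit, so
  \<open>A\<close> and \<open>B\<close> are not treated separately. The sum of their two pairings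
  does converge; the resulting joint monotonicity relation is split afterwards by choosing test
  points.\<close>

lemma weak_cluster_solution:
  assumes sol: "solution p0 a0 r0" and H: "H \<noteq> bot" "H \<le> sequentially"
    and cl: "weak_cluster H p zb sb"
  shows "solution p (zb - p) (G sb)" "sb = M (G sb)"
proof -
  obtain K where Kz: "\<And>k. norm (z k) \<le> K" and Kx: "\<And>k. norm (x k) \<le> K"
    and Ky: "\<And>k. norm (y k) \<le> K" and KB: "\<And>k. norm (B (y k)) \<le> K"
    and Kq: "\<And>k. norm (M (q k)) \<le> K"
    using bounded_iterates[OF sol] by blast
  have wz: "\<And>u. ((\<lambda>k. inner (z (Suc k)) u) \<longlongrightarrow> inner zb u) H"
    and wx: "\<And>u. ((\<lambda>k. inner (x (Suc k)) u) \<longlongrightarrow> inner p u) H"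
    and ws: "\<And>u. ((\<lambda>k. inner (M (q (Suc k))) u) \<longlongrightarrow> inner sb u) H"
    using cl by (auto simp: weak_cluster_def)
  have toH: "(f \<longlongrightarrow> l) H" if "f \<longlonglongrightarrow> l" for f :: "nat \<Rightarrow> 'h" and l
    using that H(2) by (rule tendsto_mono[rotated])
  note inc = increments[OF sol, THEN toH]
  have inner0: "((\<lambda>k. inner (f k) u) \<longlongrightarrow> 0) H" if "(f \<longlongrightarrow> 0) H" for f u
    by (rule inner_tendsto_zero[OF that, of _ "norm u"]) simp
  let ?a = "\<lambda>k. z (Suc k) - x (Suc k)"
  \<comment> \<open>Residual of the inclusion; by \<open>z_Suc\<close> it is minus the next
    increment of \<open>z\<close> minus the increment of \<open>B y\<close>.\<close>
  define e where "e k = ?a k + B (y (Suc k)) + M (q (Suc k))" for k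
  have "(\<lambda>k. - (z (Suc (Suc k)) - z (Suc k)) - (B (y (Suc k)) - B (y k))) \<longlonglongrightarrow> - 0 - 0"
    by (intro tendsto_intros LIMSEQ_Suc[OF asymptotic(2)[OF sol]] increments(2)[OF sol])
  then have "e \<longlonglongrightarrow> 0"
    unfolding e_def by (simp add: z_Suc scaleR_2 algebra_simps)
  then have e0: "(e \<longlongrightarrow> 0) H" by (rule toH)

  show sb: "sb = M (G sb)"
  proof (rule vector_eq_rdot[THEN iffD1, OF allI])
    fix u
    have "bounded_linear (\<lambda>s. M (G s))"
      by (rule bounded_linear_compose[OF M_linear G_linear])
    from bounded_linear_weak_limit[OF this ws, of u]
    have "((\<lambda>k. inner (M (q (Suc k))) u) \<longlongrightarrow> inner (M (G sb)) u) H"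
      by (simp add: M_G_M)
    with ws[of u] show "inner sb u = inner (M (G sb)) u"
      by (rule tendsto_unique[OF H(1)])
  qed
  have Mp: "M p = 0"
  proof (rule vector_eq_rdot[THEN iffD1, OF allI])
    fix u
    show "inner (M p) u = inner 0 u"
      using tendsto_unique[OF H(1) bounded_linear_weak_limit[OF M_linear wx, of u] inner0[OF inc(3)]]
      by simp
  qed
  have wa: "((\<lambda>k. inner (?a k) u) \<longlongrightarrow> inner (zb - p) u) H" for u
    using tendsto_diff[OF wz[of u] wx[of u]] by (simp add: inner_diff_left)
  define bb where "bb = - (zb - p) - sb"
  have wb: "((\<lambda>k. inner (B (y (Suc k))) u) \<longlongrightarrow> inner bb u) H" for u
    using tendsto_diff[OF tendsto_diff[OF inner0[OF e0, of u] wa[of u]] ws[of u]]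
    by (simp add: e_def bb_def inner_simps)
  have wy: "((\<lambda>k. inner (y (Suc k)) u) \<longlongrightarrow> inner p u) H" for u
    using tendsto_add[OF inner0[OF inc(1), of u] wx[of u]] by (simp add: inner_simps)
  have cross: "((\<lambda>k. inner (x (Suc k)) (?a k) + inner (y (Suc k)) (B (y (Suc k)))) \<longlongrightarrow> 0) H"
  proof -
    obtain C where C: "\<And>s. norm (G s) \<le> norm s * C" "0 \<le> C"
      using G.nonneg_bounded by blast
    \<comment> \<open>Since \<open>M (G (M q)) = M q\<close>, symmetry moves \<open>M\<close> onto
      \<open>x\<close>: \<open>M x\<close> tends to 0 strongly and \<open>G (M q)\<close> is
      bounded.\<close>
    have "((\<lambda>k. inner (M (x (Suc k))) (G (M (q (Suc k))))) \<longlongrightarrow> 0) H"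
      by (rule inner_tendsto_zero[OF inc(3), of _ "K * C"])
         (rule order_trans[OF C(1) mult_right_mono[OF Kq C(2)]])
    then have "((\<lambda>k. inner (x (Suc k)) (M (q (Suc k)))) \<longlongrightarrow> 0) H"
      by (simp add: M_sym M_G_M)
    moreover have "((\<lambda>k. inner (e k) (x (Suc k))) \<longlongrightarrow> 0) H"
      by (rule inner_tendsto_zero[OF e0 Kx])
    moreover have "((\<lambda>k. inner (y (Suc k) - x (Suc k)) (B (y (Suc k)))) \<longlongrightarrow> 0) H"
      by (rule inner_tendsto_zero[OF inc(1) KB])
    ultimately have "((\<lambda>k. inner (e k) (x (Suc k)) - inner (x (Suc k)) (M (q (Suc k)))
        + inner (y (Suc k) - x (Suc k)) (B (y (Suc k)))) \<longlongrightarrow> 0 - 0 + 0) H"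
      by (intro tendsto_intros)
    then show ?thesis
      by (simp add: e_def inner_simps inner_commute algebra_simps)
  qed
  \<comment> \<open>Hence the limit 0 in \<open>cross\<close> equals
    \<open>inner p (zb - p) + inner p bb\<close>, as the relation below requires.\<close>
  have p_sb: "inner p sb = 0"
    using M_sym[of p "G sb"] Mp sb by simp
  have related: "0 \<le> inner (p - w) (zb - p - c) + inner (p - w') (bb - B w')" if "c \<in> A w" for w c w'
  proof -
    have "((\<lambda>k. (inner (x (Suc k)) (?a k) + inner (y (Suc k)) (B (y (Suc k))))
          - inner (x (Suc k)) c - (inner (?a k) w - inner c w)
          - inner (y (Suc k)) (B w') - (inner (B (y (Suc k))) w' - inner (B w') w'))
        \<longlongrightarrow> 0 - inner p c - (inner (zb - p) w - inner c w)
          - inner p (B w') - (inner bb w' - inner (B w') w')) H"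
      by (intro tendsto_diff tendsto_const cross wx wa wy wb)
    moreover have "0 \<le> (inner (x (Suc k)) (?a k) + inner (y (Suc k)) (B (y (Suc k))))
          - inner (x (Suc k)) c - (inner (?a k) w - inner c w)
          - inner (y (Suc k)) (B w') - (inner (B (y (Suc k))) w' - inner (B w') w')" for k
    proof -
      have "0 \<le> inner (x (Suc k) - w) (?a k - c)" using A_inner[OF z_x that] .
      moreover have "0 \<le> inner (y (Suc k) - w') (B (y (Suc k)) - B w')"
        using B_mono unfolding monotone_fun_def by blast
      ultimately show ?thesis by (simp add: inner_simps inner_commute algebra_simps)
    qed
    ultimately have "0 \<le> 0 - inner p c - (inner (zb - p) w - inner c w)
          - inner p (B w') - (inner bb w' - inner (B w') w')"
      using H(1) by (intro tendsto_lowerbound) (auto intro: always_eventually)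
    also have "\<dots> = inner (p - w) (zb - p - c) + inner (p - w') (bb - B w')"
      using p_sb by (simp add: bb_def inner_simps inner_commute algebra_simps)
    finally show ?thesis .
  qed
  \<comment> \<open>At the resolvent point \<open>w\<close> of \<open>zb\<close>, with
    \<open>p\<close> as second test point, the relation becomes minus the squared norm of
    \<open>p - w\<close>. The pair \<open>(p, zb - p)\<close> can then be tested itself, which
    isolates \<open>B\<close>.\<close>
  obtain w where w: "zb - w \<in> A w" using A_range by blast
  from related[OF w, of p] have "inner (p - w) (p - w) \<le> 0"
    by (simp add: inner_simps inner_commute algebra_simps)
  then have "p = w" using inner_ge_zero[of "p - w"] by simp
  with w have aA: "zb - p \<in> A p" by simp
  have "bb = B p"
  proof (rule lipschitz_related_imp_eq[OF B_lip L(1)])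
    show "0 \<le> inner (p - w) (bb - B w)" for w using related[OF aA, of w] by simp
  qed
  then show "solution p (zb - p) (G sb)"
    unfolding solution_def using aA Mp \<open>bb = B p\<close>[symmetric] sb[symmetric]
    by (simp add: bb_def)
qed

text \<open>Opial's argument: for two weak cluster points the difference of the two convergent
  distances is, up to a constant, a continuous linear functional of the iterates.\<close>
lemma weak_cluster_unique:
  assumes sol: "solution p0 a0 r0"
    and H1: "H1 \<noteq> bot" "H1 \<le> sequentially" "weak_cluster H1 p1 z1 s1"
    and H2: "H2 \<noteq> bot" "H2 \<le> sequentially" "weak_cluster H2 p2 z2 s2"
  shows "z1 = z2" "p1 = p2"
proof -
  note sol1 = weak_cluster_solution[OF sol H1] and sol2 = weak_cluster_solution[OF sol H2]
  let ?g1 = "G s1" and ?g2 = "G s2"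
  define \<phi> where "\<phi> k = inner (z (Suc k)) (z1 - z2) + R (q (Suc k)) (?g1 - ?g2)" for k
  \<comment> \<open>Here \<open>w\<close> enters only through \<open>M w\<close>, so weak limits of
    \<open>M q\<close> suffice.\<close>
  have R_eq: "R w (?g1 - ?g2) = inner (M w) (?g1 - ?g2) / \<beta> - inner (M w) (M (?g1 - ?g2))" for w
    by (simp add: R_def M_sym)
  have lim: "(\<phi> \<longlongrightarrow> inner zb (z1 - z2) + R (G sb) (?g1 - ?g2)) H"
    if "weak_cluster H p zb sb" "sb = M (G sb)" for H p zb sb
    unfolding \<phi>_def R_eq that(2)[symmetric]
    using that(1) params unfolding weak_cluster_def
    by (intro tendsto_add tendsto_diff tendsto_divide tendsto_const) auto
  obtain c1 where c1: "distance p1 (z1 - p1) ?g1 \<longlonglongrightarrow> c1"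
    using distance_convergent[OF sol1(1)] by (auto simp: convergent_def)
  obtain c2 where c2: "distance p2 (z2 - p2) ?g2 \<longlonglongrightarrow> c2"
    using distance_convergent[OF sol2(1)] by (auto simp: convergent_def)
  have dz: "(\<lambda>k. inner (z (Suc (Suc k)) - z (Suc k)) (z1 - z2)) \<longlonglongrightarrow> 0"
    by (rule inner_tendsto_zero[OF LIMSEQ_Suc[OF asymptotic(2)[OF sol]], of _ "norm (z1 - z2)"]) simp
  \<comment> \<open>\<open>distance\<close> carries \<open>z\<close> one index ahead of
    \<open>\<phi>\<close>; the increment correcting this in \<open>\<phi>_eq\<close> has the limit
    written as \<open>- 0\<close>.\<close>
  define c where "c = (inner z1 z1 - inner z2 z2 + R ?g1 ?g1 - R ?g2 ?g2 - (c1 - c2)) / 2 - 0"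
  have \<phi>_eq: "\<phi> k = (inner z1 z1 - inner z2 z2 + R ?g1 ?g1 - R ?g2 ?g2
      - (distance p1 (z1 - p1) ?g1 k - distance p2 (z2 - p2) ?g2 k)) / 2
      - inner (z (Suc (Suc k)) - z (Suc k)) (z1 - z2)" for k
    by (simp add: \<phi>_def distance_def power2_norm_eq_inner inner_simps inner_commute
        R_diff R_diff_right R_commute[of "G _" "q _"] field_simps)
  have "\<phi> \<longlonglongrightarrow> c"
    unfolding \<phi>_eq[abs_def] c_def by (intro tendsto_intros c1 c2 dz) simp
  then have "inner z1 (z1 - z2) + R ?g1 (?g1 - ?g2) = c" "inner z2 (z1 - z2) + R ?g2 (?g1 - ?g2) = c"
    using tendsto_unique[OF H1(1) lim[OF H1(3) sol1(2)] tendsto_mono[OF H1(2)]]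
      tendsto_unique[OF H2(1) lim[OF H2(3) sol2(2)] tendsto_mono[OF H2(2)]] by auto
  then have "inner (z1 - z2) (z1 - z2) + R (?g1 - ?g2) (?g1 - ?g2) = 0"
    by (simp add: inner_diff_left[of z1 z2 "z1 - z2"] R_diff[of ?g1 ?g2 "?g1 - ?g2"])
  \<comment> \<open>\<open>R\<close> is only semidefinite, so the dual parts are not identified;
    \<open>p\<close> is recovered below as the resolvent of the \<open>z\<close>-limit.\<close>
  then show z: "z1 = z2"
    using R_nonneg[of "?g1 - ?g2"] inner_ge_zero[of "z1 - z2"]
    by (metis add_nonneg_eq_0_iff inner_eq_zero_iff right_minus_eq)
  have "z1 - p1 \<in> A p1" "z2 - p2 \<in> A p2"
    using sol1(1) sol2(1) by (auto simp: solution_def)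
  from A_norm_le(1)[OF this] show "p1 = p2" using z by simp
qed

theorem weak_convergence:
  assumes sol: "solution p0 a0 r0"
  obtains p zs r where "weak_conv z zs" "weak_conv x p" "weak_conv y p" "solution p (zs - p) r"
proof -
  obtain H p zs s where H: "H \<noteq> bot" "H \<le> sequentially" "weak_cluster H p zs s"
    by (rule weak_cluster_exists[OF sol sequentially_bot])
  have cl: "\<exists>G. G \<noteq> bot \<and> G \<le> F \<and> (\<exists>s. weak_cluster G p zs s)"
    if "F \<noteq> bot" "F \<le> sequentially" for F
  proof -
    obtain G p' zs' s' where G: "G \<noteq> bot" "G \<le> F" "weak_cluster G p' zs' s'"
      by (rule weak_cluster_exists[OF sol \<open>F \<noteq> bot\<close>])
    with weak_cluster_unique[OF sol H G(1) order_trans[OF G(2) that(2)] G(3)] show ?thesis by blast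
  qed
  have z: "(\<lambda>k. inner (z (Suc k)) u) \<longlonglongrightarrow> inner zs u" for u
    by (rule tendsto_by_subfilters) (use cl in \<open>fastforce simp: weak_cluster_def\<close>)
  have x: "(\<lambda>k. inner (x (Suc k)) u) \<longlonglongrightarrow> inner p u" for u
    by (rule tendsto_by_subfilters) (use cl in \<open>fastforce simp: weak_cluster_def\<close>)
  have "(\<lambda>k. inner (y (Suc k) - x (Suc k)) u) \<longlonglongrightarrow> 0" for u
    by (rule inner_tendsto_zero[OF increments(1)[OF sol], of _ "norm u"]) simp
  then have y: "(\<lambda>k. inner (y (Suc k)) u) \<longlonglongrightarrow> inner p u" for u
    using tendsto_add[OF _ x[of u], of "\<lambda>k. inner (y (Suc k) - x (Suc k)) u" 0]
    by (simp add: inner_diff_left)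
  show ?thesis
    by (rule that[OF _ _ _ weak_cluster_solution(1)[OF sol H]])
       (use x y z in \<open>auto simp: weak_conv_def intro: LIMSEQ_imp_Suc\<close>)
qed

end

section \<open>Real matrices acting on the product space\<close>

lemma inner_mat_act:
  fixes u w :: "'a::real_inner ^ 'n::finite"
  shows "inner (mat_act M u) w = inner u (mat_act (transpose M) w)"
  by (simp add: inner_vec_def mat_act_def transpose_def inner_sum_left inner_sum_right)
     (rule sum.swap)

lemma linear_mat_act: "linear (mat_act M :: 'a::real_vector ^ 'n::finite \<Rightarrow> _)"
  by (rule linearI)
     (simp_all add: mat_act_def vec_eq_iff scaleR_add_right sum.distrib scaleR_sum_right mult.commute)

lemma bounded_linear_mat_act:
  "bounded_linear (mat_act M :: 'a::real_normed_vector ^ 'n::finite \<Rightarrow> _)"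
proof (rule bounded_linear.intro[OF linear_mat_act], unfold_locales)
  define K where "K = (\<Sum>i\<in>UNIV. \<Sum>j\<in>UNIV. \<bar>M $ i $ j\<bar>)"
  have "norm (mat_act M u) \<le> norm u * K" for u :: "'a ^ 'n"
  proof -
    have "norm (mat_act M u) \<le> (\<Sum>i\<in>UNIV. norm (mat_act M u $ i))"
      by (simp add: norm_vec_def L2_set_le_sum)
    also have "\<dots> \<le> (\<Sum>i\<in>UNIV. \<Sum>j\<in>UNIV. \<bar>M $ i $ j\<bar> * norm u)"
      unfolding mat_act_def
      by (auto intro!: sum_mono order_trans[OF norm_sum] mult_left_mono Finite_Cartesian_Product.norm_nth_le)
    also have "\<dots> = norm u * K"
      by (simp add: K_def sum_distrib_left mult.commute)
    finally show ?thesis .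
  qed
  then show "\<exists>K. \<forall>u. norm (mat_act M u :: 'a ^ 'n) \<le> norm u * K" by blast
qed

lemma mat_act_mult: "mat_act (M ** P) u = mat_act M (mat_act P u)"
  unfolding mat_act_def matrix_matrix_mult_def vec_eq_iff
  by (simp add: scaleR_sum_left scaleR_sum_right) (intro allI sum.swap)

lemma mat_act_mat_1: "mat_act (mat 1) u = u"
proof -
  have "(\<Sum>j\<in>UNIV. (if i = j then 1 else 0) *\<^sub>R u $ j) = u $ i" for i
    by (simp add: if_distrib[of "\<lambda>c. c *\<^sub>R _"] cong: if_cong)
  then show ?thesis by (simp add: mat_act_def mat_def vec_eq_iff)
qed

lemma mat_act_diff_matrix: "mat_act (M - P) u = mat_act M u - mat_act P u"
  by (simp add: mat_act_def vec_eq_iff scaleR_diff_left sum_subtractf)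

lemma mat_act_scaleR_matrix: "mat_act (c *\<^sub>R M) u = c *\<^sub>R mat_act M u"
  by (simp add: mat_act_def vec_eq_iff scaleR_sum_right)

lemma mat_act_diag_mat: "mat_act (diag_mat d) u = (\<chi> i. d i *\<^sub>R u $ i)"
  by (simp add: mat_act_def diag_mat_def vec_eq_iff if_distrib[of "\<lambda>c. c *\<^sub>R _"] cong: if_cong)

lemma matrix_vector_mult_eq_mat_act: "M *v u = mat_act M u"
  by (simp add: mat_act_def matrix_vector_mult_def)

text \<open>Pairing with a fixed \<open>h\<close> intertwines \<open>mat_act\<close> with the real
  matrix, so kernel and range facts transfer by testing against every \<open>h\<close>.\<close>

lemma inner_mat_act_component:
  "inner (mat_act M u $ i) h = (M *v (\<chi> j. inner (u $ j) h)) $ i"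
  by (simp add: mat_act_def matrix_vector_mult_def inner_sum_left)

text \<open>Gram-Schmidt: each new vector contributes its normalized residual unless that residual
  is zero.\<close>

lemma orthonormal_expansion:
  fixes S :: "'a::real_inner set"
  assumes "finite S"
  shows "\<exists>F. finite F \<and> (\<forall>e\<in>F. \<forall>f\<in>F. inner e f = (if e = f then 1 else 0))
    \<and> (\<forall>w\<in>S. w = (\<Sum>e\<in>F. inner w e *\<^sub>R e))"
  using assms
proof (induction S rule: finite_induct)
  case empty
  show ?case by (rule exI[of _ "{}"]) simp
next
  case (insert w S)
  then obtain F where F: "finite F" "\<And>e f. e \<in> F \<Longrightarrow> f \<in> F \<Longrightarrow> inner e f = (if e = f then 1 else 0)"
      "\<And>w. w \<in> S \<Longrightarrow> w = (\<Sum>e\<in>F. inner w e *\<^sub>R e)"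
    by blast
  define r where "r = w - (\<Sum>e\<in>F. inner w e *\<^sub>R e)"
  have orth: "inner r f = 0" if "f \<in> F" for f
  proof -
    have "inner (\<Sum>e\<in>F. inner w e *\<^sub>R e) f = (\<Sum>e\<in>F. if e = f then inner w e else 0)"
      unfolding inner_sum_left using F(2)[OF _ that] by (intro sum.cong) auto
    also have "\<dots> = inner w f" using F(1) that by simp
    finally show ?thesis by (simp add: r_def inner_diff_left)
  qed
  show ?case
  proof (cases "r = 0")
    case True
    with F show ?thesis by (intro exI[of _ F]) (auto simp: r_def)
  next
    case False
    define g where "g = r /\<^sub>R norm r"
    have gg: "inner g g = 1"
      using False by (simp add: g_def dot_square_norm power2_eq_square)
    have gF: "inner g f = 0" "inner f g = 0" if "f \<in> F" for f
      using orth[OF that] by (simp_all add: g_def inner_commute)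
    then have "g \<notin> F" using gg by fastforce
    have "inner (\<Sum>e\<in>F. c e *\<^sub>R e) g = 0" for c
      using gF by (simp add: inner_sum_left)
    note sum_g = this
    have "inner w g *\<^sub>R g = r"
    proof -
      have "inner w g = inner r g" using sum_g by (simp add: r_def inner_diff_left)
      also have "\<dots> = norm r" using False by (simp add: g_def dot_square_norm power2_eq_square)
      finally show ?thesis using False by (simp add: g_def)
    qed
    then have "w = (\<Sum>e\<in>insert g F. inner w e *\<^sub>R e)"
      using F(1) \<open>g \<notin> F\<close> by (simp add: r_def)
    moreover have "v = (\<Sum>e\<in>insert g F. inner v e *\<^sub>R e)" if "v \<in> S" for v
    proof -
      have "inner v g = 0" using sum_g F(3)[OF that] by metis
      then show ?thesis using F(1) \<open>g \<notin> F\<close> F(3)[OF that] by simp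
    qed
    moreover have "inner e f = (if e = f then 1 else 0)"
      if "e \<in> insert g F" "f \<in> insert g F" for e f
      using that F(2) gg gF \<open>g \<notin> F\<close> by auto
    ultimately show ?thesis using F(1) by (intro exI[of _ "insert g F"]) blast
  qed
qed

text \<open>In an orthonormal basis of the span of its components, a vector of \<open>'a ^ 'n\<close> splits into
  finitely many real vectors, on each of which the real inequality can be used.\<close>
lemma mat_act_square_bound:
  fixes M :: "real ^ 'n ^ 'n::finite" and u :: "'a::real_inner ^ 'n"
  assumes real: "\<And>w :: real ^ 'n. (norm (M *v w))\<^sup>2 \<le> \<mu> * inner w (M *v w)"
  shows "(norm (mat_act M u))\<^sup>2 \<le> \<mu> * inner u (mat_act M u)"
proof -
  obtain F where F: "finite F" "\<And>e f. e \<in> F \<Longrightarrow> f \<in> F \<Longrightarrow> inner e f = (if e = f then 1 else 0)"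
      "\<And>i. u $ i = (\<Sum>e\<in>F. inner (u $ i) e *\<^sub>R e)"
    using orthonormal_expansion[of "range (\<lambda>i. u $ i)"] by (auto 0 4)
  define c :: "'a \<Rightarrow> real ^ 'n" where "c e = (\<chi> j. inner (u $ j) e)" for e
  have inner_u: "inner (u $ i) w = (\<Sum>e\<in>F. c e $ i * inner w e)" for i w
  proof -
    have "inner (u $ i) w = inner (\<Sum>e\<in>F. inner (u $ i) e *\<^sub>R e) w"
      by (rule arg_cong[OF F(3)])
    then show ?thesis by (simp add: inner_sum_left c_def inner_commute[of w])
  qed
  have comp: "inner (mat_act M u $ i) e = (M *v c e) $ i" for i e
    unfolding c_def by (rule inner_mat_act_component)
  have inner_Mu: "inner (mat_act M u $ i) w = (\<Sum>e\<in>F. (M *v c e) $ i * inner w e)" for i w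
  proof -
    have "inner (mat_act M u $ i) w = (\<Sum>j\<in>UNIV. M $ i $ j * (\<Sum>e\<in>F. c e $ j * inner w e))"
      by (simp add: mat_act_def inner_sum_left inner_u)
    also have "\<dots> = (\<Sum>e\<in>F. \<Sum>j\<in>UNIV. M $ i $ j * (c e $ j * inner w e))"
      unfolding sum_distrib_left by (rule sum.swap)
    finally show ?thesis
      by (simp add: matrix_vector_mult_def sum_distrib_right mult.assoc)
  qed
  have "inner (mat_act M u $ i) (mat_act M u $ i) = (\<Sum>e\<in>F. (M *v c e) $ i * (M *v c e) $ i)" for i
    by (subst inner_Mu) (simp add: comp)
  then have "(norm (mat_act M u))\<^sup>2 = (\<Sum>i\<in>UNIV. \<Sum>e\<in>F. (M *v c e) $ i * (M *v c e) $ i)"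
    by (simp add: power2_norm_eq_inner inner_vec_def)
  also have "\<dots> = (\<Sum>e\<in>F. (norm (M *v c e))\<^sup>2)"
    by (subst sum.swap) (simp add: power2_norm_eq_inner inner_vec_def)
  also have "\<dots> \<le> (\<Sum>e\<in>F. \<mu> * inner (c e) (M *v c e))"
    by (intro sum_mono real)
  also have "\<dots> = \<mu> * (\<Sum>i\<in>UNIV. \<Sum>e\<in>F. c e $ i * (M *v c e) $ i)"
    by (subst sum.swap) (simp add: sum_distrib_left inner_vec_def)
  also have "\<dots> = \<mu> * inner u (mat_act M u)"
    by (simp add: inner_vec_def inner_u comp)
  finally show ?thesis .
qed

text \<open>Positivity is tested at \<open>u - f u / m\<close>; the norm bound makes the last term
  of the expansion at most half the size of the middle one.\<close>

lemma psd_square_bound: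
  fixes f :: "'a::real_inner \<Rightarrow> 'a"
  assumes f: "linear f" and sym: "\<And>u w. inner (f u) w = inner u (f w)"
    and psd: "\<And>u. 0 \<le> inner u (f u)"
    and bound: "\<And>u. norm (f u) \<le> m * norm u" and "0 < m"
  shows "(norm (f u))\<^sup>2 \<le> m * inner u (f u)"
proof -
  interpret linear f by fact
  have "0 \<le> inner (u - (1 / m) *\<^sub>R f u) (f (u - (1 / m) *\<^sub>R f u))" by (rule psd)
  moreover have "\<dots> = inner u (f u) - 2 / m * (norm (f u))\<^sup>2 + (1 / m)\<^sup>2 * inner (f u) (f (f u))"
    using sym[of u "f u"] power2_norm_eq_inner[of "f u", unfolded power2_eq_square]
    by (simp add: diff scale inner_simps power2_norm_eq_inner power2_eq_square algebra_simps)
  moreover have "inner (f u) (f (f u)) \<le> m * (norm (f u))\<^sup>2"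
    using order_trans[OF norm_cauchy_schwarz mult_left_mono[OF bound norm_ge_zero]]
    by (simp add: power2_eq_square mult_ac)
  then have "(1 / m)\<^sup>2 * inner (f u) (f (f u)) \<le> 1 / m * (norm (f u))\<^sup>2"
    using \<open>0 < m\<close> by (simp add: power2_eq_square field_simps)
  ultimately have "0 \<le> inner u (f u) - 1 / m * (norm (f u))\<^sup>2" by argo
  then show ?thesis using \<open>0 < m\<close> by (simp add: field_simps)
qed

section \<open>Generalized inverses, kernels and ranges\<close>

lemma generalized_inverse_exists:
  fixes M :: "real ^ 'n ^ 'm"
  obtains G where "M ** G ** M = M"
proof -
  have "linear ((*v) M)" by simp
  then obtain g where g: "linear g" "\<forall>w\<in>(*v) M ` UNIV. M *v g w = w"
    using linear_exists_right_inverse_on[of "(*v) M" UNIV] by auto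
  have "(M ** matrix g ** M) *v u = M *v u" for u
    using g by (simp add: matrix_vector_mul_assoc[symmetric] matrix_works)
  then have "M ** matrix g ** M = M" by (simp add: matrix_eq)
  then show ?thesis by (rule that)
qed

lemma mat_act_kernel_const:
  fixes M :: "real ^ 'n ^ 'n::finite" and u :: "'a::real_inner ^ 'n"
  assumes ker: "\<And>w :: real ^ 'n. M *v w = 0 \<Longrightarrow> w \<in> range (\<lambda>c. c *\<^sub>R 1)" and u: "mat_act M u = 0"
  shows "u $ i = u $ j"
proof (rule vector_eq_rdot[THEN iffD1, OF allI])
  fix h
  have "M *v (\<chi> j. inner (u $ j) h) = 0"
    by (simp add: vec_eq_iff inner_mat_act_component[symmetric] u)
  from ker[OF this] obtain c where "(\<chi> j. inner (u $ j) h) = c *\<^sub>R (1 :: real ^ 'n)" by blast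
  then show "inner (u $ i) h = inner (u $ j) h"
    by (metis (mono_tags) one_index scaleR_vec_def vec_lambda_beta)
qed

text \<open>The kernel of a symmetric matrix is the orthogonal complement of its range, and in
  finite dimension the double complement of the range is the range.\<close>

lemma symmetric_matrix_range:
  fixes M :: "real ^ 'n ^ 'n::finite"
  assumes "transpose M = M" and orth: "\<And>w. M *v w = 0 \<Longrightarrow> inner v w = 0"
  shows "v \<in> range ((*v) M)"
proof -
  have lin: "linear ((*v) M)" by simp
  have "adjoint ((*v) M) = (*v) M"
    by (simp add: adjoint_matrix assms(1))
  then have "{w. M *v w = 0} = (range ((*v) M))\<^sup>\<bottom>"
    using ker_orthogonal_comp_adjoint[OF lin] by (auto simp: vimage_def)
  moreover have "v \<in> {w. M *v w = 0}\<^sup>\<bottom>"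
    using orth by (auto simp: orthogonal_comp_def orthogonal_def inner_commute)
  ultimately show ?thesis
    using orthogonal_comp_self[OF linear_subspace_image[OF lin subspace_UNIV]] by simp
qed

text \<open>\<open>M ** G\<close> fixes the range of \<open>M\<close>. For each \<open>h\<close> the
  pairings of \<open>s\<close> with \<open>h\<close> form a real vector orthogonal to the constants,
  hence in that range.\<close>

lemma mat_act_range:
  fixes M :: "real ^ 'n ^ 'n::finite" and s :: "'a::real_inner ^ 'n"
  assumes "transpose M = M" and ker: "\<And>w :: real ^ 'n. M *v w = 0 \<Longrightarrow> w \<in> range (\<lambda>c. c *\<^sub>R 1)"
    and s: "(\<Sum>i\<in>UNIV. s $ i) = 0"
  shows "s \<in> range (mat_act M)"
proof -
  obtain G where G: "M ** G ** M = M" by (rule generalized_inverse_exists)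
  have "mat_act M (mat_act G s) $ i = s $ i" for i
  proof (rule vector_eq_rdot[THEN iffD1, OF allI])
    fix h
    let ?w = "\<chi> j. inner (s $ j) h"
    have "?w \<in> range ((*v) M)"
    proof (rule symmetric_matrix_range[OF assms(1)])
      fix w assume "M *v w = 0"
      then obtain c where w: "w = c *\<^sub>R 1" using ker by blast
      have "inner ?w w = c * inner (\<Sum>i\<in>UNIV. s $ i) h"
        by (simp add: w inner_vec_def inner_sum_left sum_distrib_left mult.commute)
      then show "inner ?w w = 0" by (simp add: s)
    qed
    then obtain r where r: "?w = M *v r" by blast
    have "(M ** G) *v ?w = ?w"
      unfolding r using G by (simp add: matrix_vector_mul_assoc)
    then show "inner (mat_act M (mat_act G s) $ i) h = inner (s $ i) h"
      by (simp add: mat_act_mult[symmetric] inner_mat_act_component)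
  qed
  then have "s = mat_act M (mat_act G s)" by (simp add: vec_eq_iff)
  then show ?thesis by (rule range_eqI)
qed

section \<open>Rescaling\<close>

lemma diag_mat_component [simp]: "mat_act (diag_mat d) u $ i = d i *\<^sub>R u $ i"
  by (simp add: mat_act_diag_mat)

lemma transpose_diag_mat: "transpose (diag_mat d) = diag_mat d"
  by (simp add: diag_mat_def transpose_def vec_eq_iff)

lemma monotone_diag_op:
  assumes "\<And>i. monotone_op (A i)" "\<And>i. 0 \<le> \<alpha> i"
  shows "monotone_op (diag_op \<alpha> A)"
  unfolding monotone_op_def
proof (intro allI impI)
  fix x y u v assume u: "u \<in> diag_op \<alpha> A x" and v: "v \<in> diag_op \<alpha> A y"
  have "0 \<le> inner (x $ i - y $ i) (u $ i - v $ i)" for i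
  proof -
    obtain b c where "u $ i = \<alpha> i *\<^sub>R b" "b \<in> A i (x $ i)" "v $ i = \<alpha> i *\<^sub>R c" "c \<in> A i (y $ i)"
      using u v by (fastforce simp: diag_op_def)
    then show ?thesis
      using assms(1)[of i] assms(2)[of i] unfolding monotone_op_def
      by (simp add: scaleR_diff_right[symmetric])
  qed
  then show "0 \<le> inner (x - y) (u - v)"
    by (simp add: inner_vec_def sum_nonneg)
qed

lemma monotone_op_scale_argument:
  assumes "monotone_op A" "0 < s"
  shows "monotone_op (\<lambda>w. A (s *\<^sub>R w))"
  unfolding monotone_op_def
proof (intro allI impI)
  fix x y u v assume "u \<in> A (s *\<^sub>R x)" "v \<in> A (s *\<^sub>R y)"
  then have "0 \<le> inner (s *\<^sub>R x - s *\<^sub>R y) (u - v)"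
    using assms(1) unfolding monotone_op_def by blast
  then show "0 \<le> inner (x - y) (u - v)"
    using assms(2) by (simp add: scaleR_diff_right[symmetric] zero_le_mult_iff)
qed

lemma diag_op_surj:
  fixes A :: "'n::finite \<Rightarrow> 'a::{real_inner, complete_space} \<Rightarrow> 'a set"
  assumes "\<And>i. maximal_monotone (A i)" "\<And>i. 0 < \<alpha> i"
  shows "\<exists>p. w - p \<in> diag_op \<alpha> A p"
proof -
  obtain p where "\<And>i. w $ i - p i \<in> (\<lambda>c. \<alpha> i *\<^sub>R c) ` A i (p i)"
  proof -
    have "\<forall>i. \<exists>x. w $ i - x \<in> (\<lambda>c. \<alpha> i *\<^sub>R c) ` A i x" using minty assms by blast
    then show ?thesis using that by metis
  qed
  then show ?thesis by (intro exI[of _ "\<chi> i. p i"]) (simp add: diag_op_def)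
qed

text \<open>Minty's existence and monotone uniqueness together give meaning to the definite
  description in \<open>resolvent\<close>.\<close>

lemma diag_op_resolvent:
  fixes A :: "'n::finite \<Rightarrow> 'a::{real_inner, complete_space} \<Rightarrow> 'a set"
  assumes "\<And>i. maximal_monotone (A i)" "\<And>i. 0 < \<alpha> i"
  shows "w - resolvent (diag_op \<alpha> A) w \<in> diag_op \<alpha> A (resolvent (diag_op \<alpha> A) w)"
proof -
  obtain p where p: "w - p \<in> diag_op \<alpha> A p" using diag_op_surj[of A \<alpha>, OF assms] by blast
  have "monotone_op (diag_op \<alpha> A)"
    using assms by (intro monotone_diag_op) (auto simp: maximal_monotone_def less_imp_le)
  from resolvent_eqI[OF this p] p show ?thesis by simp
qed

text \<open>Of the two factors in \<open>\<alpha> i = s i * s i\<close> one cancels; the other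
  remains as the outer factor of the conjugated operator.\<close>

lemma diag_op_rescale:
  assumes "\<And>i. 0 < s i" "\<And>i. \<alpha> i = s i * s i"
  shows "mat_act (diag_mat s) u \<in> diag_op \<alpha> A (mat_act (diag_mat s) p)
    \<longleftrightarrow> u \<in> diag_op s (\<lambda>i w. A i (s i *\<^sub>R w)) p"
proof -
  have "s i *\<^sub>R u $ i = \<alpha> i *\<^sub>R c \<longleftrightarrow> u $ i = s i *\<^sub>R c" for i c
    using assms(1)[of i] by (simp add: assms(2) scaleR_scaleR[symmetric] del: scaleR_scaleR)
  then show ?thesis by (simp add: diag_op_def image_iff)
qed

lemma weak_conv_mat_act:
  "weak_conv u l \<Longrightarrow> weak_conv (\<lambda>k. mat_act M (u k)) (mat_act M l)"
  by (simp add: weak_conv_def inner_mat_act)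

section \<open>Laplacian matrices and constant vectors\<close>

lemma laplacian_const:
  fixes K :: "real ^ 'n ^ 'n::finite" and h :: "'a::real_inner"
  assumes "K *v 1 = 0"
  shows "mat_act K (\<chi> i. h) = 0"
proof -
  have "(\<Sum>j\<in>UNIV. K $ i $ j) = 0" for i
    using assms by (simp add: vec_eq_iff matrix_vector_mult_def)
  then show ?thesis by (simp add: vec_eq_iff mat_act_def scaleR_sum_left[symmetric])
qed

lemma sum_laplacian:
  fixes K :: "real ^ 'n ^ 'n::finite" and w :: "'a::real_inner ^ 'n"
  assumes "K *v 1 = 0" "transpose K = K"
  shows "(\<Sum>i\<in>UNIV. mat_act K w $ i) = 0"
proof (rule vector_eq_rdot[THEN iffD1, OF allI])
  fix h
  have "inner (\<Sum>i\<in>UNIV. mat_act K w $ i) h = inner (mat_act K w) (\<chi> i. h)"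
    by (simp add: inner_vec_def inner_sum_left)
  also have "\<dots> = inner w (mat_act K (\<chi> i. h))" by (simp add: inner_mat_act assms(2))
  finally show "inner (\<Sum>i\<in>UNIV. mat_act K w $ i) h = inner 0 h"
    by (simp add: laplacian_const[OF assms(1)])
qed

theorem theorem3p4:
  fixes A :: "'n::finite \<Rightarrow> 'a::{real_inner, complete_space} \<Rightarrow> 'a set"
    and B :: "'n \<Rightarrow> 'a \<Rightarrow> 'a"
    and L \<alpha> :: "'n \<Rightarrow> real" and \<beta> :: real
    and E :: "('n \<times> 'n) set" and W :: "real ^ 'n ^ 'n"
    and x y z v :: "nat \<Rightarrow> 'a ^ 'n"
  assumes A_mm: "\<And>i. maximal_monotone (A i)"
    and B_mono: "\<And>i. monotone_fun (B i)"
    and B_lip: "\<And>i. (L i)-lipschitz_on UNIV (B i)"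
    and zeros_ne: "zeros_sum A B \<noteq> {}"
    and graph: "connected_graph E"
    and mix: "mixing_matrix E W"
    and alpha_pos: "\<And>i. 0 < \<alpha> i"
    and alpha_bd: "\<And>i. 8 * L i * \<alpha> i < 1"
    and beta_pos: "0 < \<beta>"
    and beta_bd: "\<beta> * onorm (\<lambda>u. (diag_mat (\<lambda>i. sqrt (\<alpha> i)) ** ((1/2) *\<^sub>R (mat 1 - W))
                      ** diag_mat (\<lambda>i. sqrt (\<alpha> i))) *v u) < 1"
    and v0: "v 0 = prod_fun B (y 0)"
    and x0: "x 0 = resolvent (diag_op \<alpha> A) (z 0)"
    and y1: "y 1 = 2 *\<^sub>R x 0 - z 0 - mat_act (diag_mat \<alpha>) (v 0)"
    and z1: "z 1 = y 1 + z 0 - x 0"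
    and x1: "x 1 = resolvent (diag_op \<alpha> A) (z 1)"
    and vk: "\<And>k. k \<ge> 1 \<Longrightarrow> v k = 2 *\<^sub>R prod_fun B (y k) - prod_fun B (y (k - 1))"
    and zk: "\<And>k. k \<ge> 1 \<Longrightarrow> z (k + 1) = z k - x k
               + mat_act (mat 1 - (\<beta> / 2) *\<^sub>R (diag_mat \<alpha> ** (mat 1 - W)))
                   (2 *\<^sub>R x k - x (k - 1) - mat_act (diag_mat \<alpha>) (v k - v (k - 1)))"
    and xk: "\<And>k. k \<ge> 1 \<Longrightarrow> x (k + 1) = resolvent (diag_op \<alpha> A) (z (k + 1))"
    and yk: "\<And>k. k \<ge> 1 \<Longrightarrow> y (k + 1) = x k + z (k + 1) - z k"
  shows "\<exists>zs. weak_conv z zs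
           \<and> weak_conv x (resolvent (diag_op \<alpha> A) zs)
           \<and> weak_conv y (resolvent (diag_op \<alpha> A) zs)
           \<and> (\<exists>xs \<in> zeros_sum A B. resolvent (diag_op \<alpha> A) zs = (\<chi> i. xs))"
proof -
  define s where "s i = sqrt (\<alpha> i)" for i
  have s_pos: "0 < s i" and s_sq: "\<alpha> i = s i * s i" for i
    using alpha_pos[of i] by (simp_all add: s_def)
  define K where "K = mat 1 - W"
  define M where "M = diag_mat s ** ((1/2) *\<^sub>R K) ** diag_mat s"
  define D where "D = (mat_act (diag_mat s) :: 'a ^ 'n \<Rightarrow> _)"
  define Di where "Di = (mat_act (diag_mat (\<lambda>i. inverse (s i))) :: 'a ^ 'n \<Rightarrow> _)"
  have lin_D: "linear D" and lin_Di: "linear Di" and lin_M: "linear (mat_act M :: 'a ^ 'n \<Rightarrow> _)"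
    and lin_K: "linear (mat_act K :: 'a ^ 'n \<Rightarrow> _)"
    unfolding D_def Di_def by (rule linear_mat_act)+
  note Di_simps = linear_add[OF lin_Di] linear_diff[OF lin_Di] linear_scale[OF lin_Di]
  note M_simps = linear_add[OF lin_M] linear_diff[OF lin_M] linear_scale[OF lin_M]
  have D_Di [simp]: "D (Di u) = u" and Di_D [simp]: "Di (D u) = u" for u
    using s_pos by (simp_all add: D_def Di_def vec_eq_iff less_imp_neq[symmetric])
  have M_eq: "mat_act M u = (1/2) *\<^sub>R D (mat_act K (D u))" for u
    by (simp add: M_def D_def mat_act_mult mat_act_scaleR_matrix linear_scale[OF linear_mat_act])
  have D_sq: "Di (mat_act (diag_mat \<alpha>) u) = D u" for u
    using s_pos by (simp add: D_def Di_def vec_eq_iff s_sq less_imp_neq[symmetric])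

  have K_sym: "transpose K = K"
    using mix by (simp add: mixing_matrix_def K_def transpose_def vec_eq_iff mat_def)
  have K_ker: "K *v w = 0 \<longleftrightarrow> w \<in> range (\<lambda>c. c *\<^sub>R 1)" for w
    using mix by (auto simp: mixing_matrix_def K_def)
  have K_one: "K *v 1 = 0" unfolding K_ker by (rule range_eqI[of _ _ 1]) simp
  have M_sym: "transpose M = M"
    by (simp add: M_def matrix_transpose_mul matrix_mul_assoc transpose_scalar K_sym transpose_diag_mat)
  have K_psd: "0 \<le> inner w (K *v w)" for w
    using mix by (simp add: mixing_matrix_def K_def matrix_vector_mult_diff_rdistrib inner_diff_right)

  define m where "m = onorm (\<lambda>u. M *v u)"
  \<comment> \<open>The midpoint of \<open>m\<close> and \<open>1 / \<beta>\<close> is positive even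
    when \<open>m = 0\<close>, and still below \<open>1 / \<beta>\<close>.\<close>
  define \<mu> where "\<mu> = (m + 1 / \<beta>) / 2"
  have m0: "0 \<le> m" unfolding m_def by (intro onorm_pos_le matrix_vector_mul_bounded_linear)
  have bm: "\<beta> * m < 1"
    using beta_bd by (simp add: m_def M_def K_def s_def[abs_def])
  have \<mu>: "0 < \<mu>" "m \<le> \<mu>" "\<beta> * \<mu> < 1"
    using m0 bm beta_pos by (auto simp: \<mu>_def field_simps intro: add_pos_nonneg)
  have M_bound: "(norm (mat_act M u))\<^sup>2 \<le> \<mu> * inner u (mat_act M u)" for u :: "'a ^ 'n"
  proof (rule mat_act_square_bound, rule psd_square_bound)
    fix u w :: "real ^ 'n"
    show "inner (M *v u) w = inner u (M *v w)"
      by (simp add: matrix_vector_mult_eq_mat_act inner_mat_act M_sym)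
    have "inner u (M *v u) = 1/2 * inner (diag_mat s *v u) (K *v (diag_mat s *v u))"
      by (simp add: matrix_vector_mult_eq_mat_act M_def mat_act_mult mat_act_scaleR_matrix
          linear_scale[OF linear_mat_act] inner_mat_act)
         (simp add: transpose_diag_mat)
    then show "0 \<le> inner u (M *v u)" using K_psd[of "diag_mat s *v u"] by linarith
    have "norm (M *v u) \<le> m * norm u"
      unfolding m_def by (intro onorm matrix_vector_mul_bounded_linear)
    also have "\<dots> \<le> \<mu> * norm u" using \<mu>(2) by (intro mult_right_mono) auto
    finally show "norm (M *v u) \<le> \<mu> * norm u" .
  qed (use \<mu> in auto)

  define A' where "A' = diag_op s (\<lambda>i w. A i (s i *\<^sub>R w))"
  define B' where "B' p = D (prod_fun B (D p))" for p
  define L' where "L' = Max (range (\<lambda>i. \<alpha> i * L i))"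
  have A'_iff: "D u \<in> diag_op \<alpha> A (D p) \<longleftrightarrow> u \<in> A' p" for u p
    unfolding A'_def D_def by (rule diag_op_rescale[OF s_pos s_sq])
  have L'_ge: "\<alpha> i * L i \<le> L'" for i unfolding L'_def by simp
  have L0: "0 \<le> L i" for i using B_lip[of i] by (rule lipschitz_on_nonneg)
  have L': "0 \<le> L'" "8 * L' < 1"
  proof -
    show "0 \<le> L'"
      using L'_ge L0 alpha_pos by (meson less_imp_le mult_nonneg_nonneg order_trans)
    have "L' \<in> range (\<lambda>i. \<alpha> i * L i)" unfolding L'_def by (rule Max_in) auto
    then show "8 * L' < 1" using alpha_bd by (auto simp: mult_ac)
  qed
  have B'_comp: "B' p $ i = s i *\<^sub>R B i (s i *\<^sub>R p $ i)" for p i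
    by (simp add: B'_def D_def prod_fun_def)

  have res: "x k = resolvent (diag_op \<alpha> A) (z k)" for k
    using x0 x1 xk[of "k - 1"] by (cases "k \<le> 1") (auto simp: le_Suc_eq)
  have y_Suc: "y (Suc k) = x k + z (Suc k) - z k" for k
    using z1 yk[of k] by (cases "k = 0") auto
  \<comment> \<open>\<open>q\<close> accumulates \<open>\<beta>\<close> times the rescaled vectors
    to which the mixing matrix is applied; the start at 0 gives the base case of
    \<open>Di_z\<close>.\<close>
  define q where "q = rec_nat (0 :: 'a ^ 'n)
    (\<lambda>k r. r + \<beta> *\<^sub>R Di (2 *\<^sub>R x (Suc k) - x k - mat_act (diag_mat \<alpha>) (v (Suc k) - v k)))"
  have q_0: "q 0 = 0"
    and q_Suc: "q (Suc k) = q k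
      + \<beta> *\<^sub>R Di (2 *\<^sub>R x (Suc k) - x k - mat_act (diag_mat \<alpha>) (v (Suc k) - v k))" for k
    by (simp_all add: q_def)
  have W_act: "Di (mat_act (mat 1 - (\<beta> / 2) *\<^sub>R (diag_mat \<alpha> ** (mat 1 - W))) u)
      = Di u - \<beta> *\<^sub>R mat_act M (Di u)" for u
    by (simp add: K_def[symmetric] mat_act_diff_matrix mat_act_mat_1 mat_act_scaleR_matrix
        mat_act_mult Di_simps D_sq M_eq)
  \<comment> \<open>\<open>y (Suc (Suc k))\<close> is the mixed vector, and mixing subtracts
    \<open>M\<close> of the increment of \<open>q\<close>. Solved for the unmixed vector, this is
    the implicit dual update.\<close>
  have y_SucSuc: "Di (y (Suc (Suc k))) = Di (2 *\<^sub>R x (Suc k) - x k - mat_act (diag_mat \<alpha>) (v (Suc k) - v k))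
      - mat_act M (q (Suc k) - q k)" for k
  proof -
    have "y (Suc (Suc k)) = mat_act (mat 1 - (\<beta> / 2) *\<^sub>R (diag_mat \<alpha> ** (mat 1 - W)))
        (2 *\<^sub>R x (Suc k) - x k - mat_act (diag_mat \<alpha>) (v (Suc k) - v k))"
      using zk[of "Suc k"] by (simp add: y_Suc)
    then show ?thesis by (simp add: W_act q_Suc M_simps)
  qed
  have Di_z: "Di (z (Suc k)) = Di (x k) - D (v k) - mat_act M (q k)" for k
  proof (induction k)
    case 0
    have "z 1 = x 0 - mat_act (diag_mat \<alpha>) (v 0)"
      using y1 z1 by (simp add: scaleR_2)
    then show ?case by (simp add: Di_simps D_sq q_0 linear_0[OF lin_M])
  next
    case (Suc k)
    have "z (Suc (Suc k)) = y (Suc (Suc k)) + z (Suc k) - x (Suc k)" by (simp add: y_Suc)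
    then have "Di (z (Suc (Suc k))) = Di (y (Suc (Suc k))) + Di (z (Suc k)) - Di (x (Suc k))"
      by (simp add: Di_simps)
    then show ?case
      unfolding y_SucSuc Suc
      by (simp add: Di_simps D_sq M_simps linear_diff[OF lin_D] scaleR_2)
  qed
  \<comment> \<open>Index 0 is left out because \<open>v 0\<close> is not reflected.\<close>
  have D_v: "D (v (Suc k)) = 2 *\<^sub>R B' (Di (y (Suc k))) - B' (Di (y k))" for k
    using vk[of "Suc k"] by (simp add: B'_def linear_diff[OF lin_D] linear_scale[OF lin_D])

  obtain G where G: "M ** G ** M = M" by (rule generalized_inverse_exists)
  interpret splitting_iteration A' B' "mat_act M" "mat_act G" L' \<beta> \<mu>
    "\<lambda>k. Di (x k)" "\<lambda>k. Di (y k)" "\<lambda>k. Di (z k)" q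
  proof (rule splitting_iteration.intro)
    show "monotone_op A'"
      unfolding A'_def using A_mm s_pos
      by (intro monotone_diag_op monotone_op_scale_argument) (auto simp: maximal_monotone_def less_imp_le)
    show "\<exists>p. w - p \<in> A' p" for w
    proof -
      obtain p where "D w - p \<in> diag_op \<alpha> A p" using diag_op_surj[of A \<alpha>, OF A_mm alpha_pos] by blast
      then have "D (w - Di p) \<in> diag_op \<alpha> A (D (Di p))" by (simp add: linear_diff[OF lin_D])
      then show ?thesis unfolding A'_iff by blast
    qed
    show "monotone_fun B'"
      unfolding monotone_fun_def
    proof (intro allI)
      fix u w
      have "0 \<le> inner (u $ i - w $ i) (B' u $ i - B' w $ i)" for i
        using B_mono[of i, unfolded monotone_fun_def, rule_format, of "s i *\<^sub>R u $ i" "s i *\<^sub>R w $ i"]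
          s_pos[of i]
        by (simp add: B'_comp scaleR_diff_right[symmetric])
      then show "0 \<le> inner (u - w) (B' u - B' w)" by (simp add: inner_vec_def sum_nonneg)
    qed
    show "norm (B' u - B' w) \<le> L' * norm (u - w)" for u w
    proof -
      have "norm ((B' u - B' w) $ i) \<le> norm ((L' *\<^sub>R (u - w)) $ i)" for i
      proof -
        have "norm ((B' u - B' w) $ i) = s i * norm (B i (s i *\<^sub>R u $ i) - B i (s i *\<^sub>R w $ i))"
          using s_pos[of i] by (simp add: B'_comp scaleR_diff_right[symmetric])
        also have "\<dots> \<le> s i * (L i * norm (s i *\<^sub>R u $ i - s i *\<^sub>R w $ i))"
          using lipschitz_onD[OF B_lip[of i]] s_pos[of i]
          by (intro mult_left_mono) (auto simp: dist_norm)
        also have "\<dots> = \<alpha> i * L i * norm (u $ i - w $ i)"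
          using s_pos[of i] by (simp add: s_sq scaleR_diff_right[symmetric])
        also have "\<dots> \<le> L' * norm (u $ i - w $ i)"
          using L'_ge by (intro mult_right_mono) auto
        finally show ?thesis using L' by simp
      qed
      then have "norm (B' u - B' w) \<le> norm (L' *\<^sub>R (u - w))" by (rule norm_le_componentwise_cart)
      then show ?thesis using L' by simp
    qed
    show "bounded_linear (mat_act M :: 'a ^ 'n \<Rightarrow> _)" "bounded_linear (mat_act G :: 'a ^ 'n \<Rightarrow> _)"
      by (rule bounded_linear_mat_act)+
    show "inner (mat_act M u) w = inner u (mat_act M w)" for u w :: "'a ^ 'n"
      by (simp add: inner_mat_act M_sym)
    show "mat_act M (mat_act G (mat_act M u)) = mat_act M u" for u :: "'a ^ 'n"
      by (metis G mat_act_mult)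
    show "Di (z k) - Di (x k) \<in> A' (Di (x k))" for k
      using diag_op_resolvent[of A \<alpha> "z k", OF A_mm alpha_pos] A'_iff[of "Di (z k) - Di (x k)" "Di (x k)"]
      by (simp add: res[symmetric] linear_diff[OF lin_D])
    show "Di (y (Suc k)) = Di (x k) + Di (z (Suc k)) - Di (z k)" for k
      by (simp add: y_Suc Di_simps)
    show "Di (z (Suc (Suc k))) = Di (x (Suc k))
        - (2 *\<^sub>R B' (Di (y (Suc k))) - B' (Di (y k))) - mat_act M (q (Suc k))" for k
      by (simp add: Di_z D_v)
    show "q (Suc k) = q k + \<beta> *\<^sub>R (Di (y (Suc (Suc k))) + mat_act M (q (Suc k) - q k))" for k
      unfolding y_SucSuc by (simp add: q_Suc)
  qed (use L' \<mu> beta_pos M_bound in auto)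

  obtain xs0 u where u: "\<And>i. u i \<in> A i xs0" "(\<Sum>i\<in>UNIV. u i + B i xs0) = 0"
    using zeros_ne by (auto simp: zeros_sum_def)
  \<comment> \<open>A vanishing sum of components means orthogonality to the kernel of
    \<open>K\<close>; a preimage under \<open>K\<close> then yields the dual part of a
    solution.\<close>
  have "(\<chi> i. u i + B i xs0) \<in> range (mat_act K)"
    using u(2) K_ker by (intro mat_act_range[OF K_sym]) auto
  then obtain w where w: "(\<chi> i. u i + B i xs0) = mat_act K w" by blast
  \<comment> \<open>The factor \<open>- 2\<close> compensates the \<open>1/2\<close> in
    \<open>M_eq\<close> and supplies the sign.\<close>
  have "solution (Di (\<chi> i. xs0)) (D (\<chi> i. u i)) (- 2 *\<^sub>R Di w)"
    unfolding solution_def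
  proof (intro conjI)
    show "D (\<chi> i. u i) \<in> A' (Di (\<chi> i. xs0))"
      unfolding A'_iff[symmetric] D_Di using u(1) s_sq by (auto simp: D_def diag_op_def)
    show "mat_act M (Di (\<chi> i. xs0)) = 0"
      by (simp add: M_eq laplacian_const[OF K_one] linear_0[OF lin_D])
    have "D (\<chi> i. u i) + B' (Di (\<chi> i. xs0)) = D (\<chi> i. u i + B i xs0)"
      by (simp add: B'_def prod_fun_def linear_add[OF lin_D, symmetric])
         (simp add: vec_eq_iff plus_vec_def)
    also have "\<dots> + mat_act M (- 2 *\<^sub>R Di w) = 0"
      by (simp add: w M_eq linear_scale[OF lin_D] linear_scale[OF lin_K] linear_neg[OF lin_D] linear_neg[OF lin_K])
    finally show "D (\<chi> i. u i) + B' (Di (\<chi> i. xs0)) + mat_act M (- 2 *\<^sub>R Di w) = 0" .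
  qed
  then obtain p zs r where lim: "weak_conv (\<lambda>k. Di (z k)) zs" "weak_conv (\<lambda>k. Di (x k)) p"
      "weak_conv (\<lambda>k. Di (y k)) p" and sol: "solution p (zs - p) r"
    by (rule weak_convergence)
  \<comment> \<open>Resolvents need not be weakly continuous; the limits are linked by the limiting
    inclusion instead.\<close>
  have "resolvent (diag_op \<alpha> A) (D zs) = D p"
  proof (rule resolvent_eqI)
    show "monotone_op (diag_op \<alpha> A)"
      using A_mm alpha_pos by (intro monotone_diag_op) (auto simp: maximal_monotone_def less_imp_le)
    show "D zs - D p \<in> diag_op \<alpha> A (D p)"
      using sol by (simp add: A'_iff linear_diff[OF lin_D, symmetric] solution_def)
  qed
  moreover have "weak_conv z (D zs)" "weak_conv x (D p)" "weak_conv y (D p)"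
    using lim[THEN weak_conv_mat_act, of "diag_mat s", folded D_def] by simp_all
  moreover have "\<exists>xs\<in>zeros_sum A B. D p = (\<chi> i. xs)"
  proof -
    have "D (mat_act K (D p)) = 0" using sol by (simp add: solution_def M_eq)
    then have "mat_act K (D p) = 0" by (metis Di_D linear_0[OF lin_Di])
    then have const: "D p $ i = D p $ j" for i j
      using K_ker by (intro mat_act_kernel_const[of K]) auto
    \<comment> \<open>All components agree, so any index, here \<open>undefined\<close>, supplies
      the common value.\<close>
    define xs where "xs = D p $ undefined"
    have Dp: "D p = (\<chi> i. xs)" using const by (simp add: xs_def vec_eq_iff)
    have "zs - p \<in> A' p" using sol by (simp add: solution_def)
    then obtain c where c: "\<And>i. (zs - p) $ i = s i *\<^sub>R c i" "\<And>i. c i \<in> A i (s i *\<^sub>R p $ i)"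
      unfolding A'_def diag_op_def by (simp add: image_iff) metis
    have sp: "s i *\<^sub>R p $ i = xs" for i using Dp by (simp add: D_def vec_eq_iff)
    \<comment> \<open>Cancelling \<open>s i\<close> leaves a Laplacian term, which vanishes on
      summation over the nodes.\<close>
    have "c i + B i xs = - (1/2) *\<^sub>R mat_act K (D r) $ i" for i
    proof -
      have "((zs - p) + B' p + mat_act M r) $ i = 0"
        using sol by (simp add: solution_def)
      then have "s i *\<^sub>R (c i + B i xs + (1/2) *\<^sub>R mat_act K (D r) $ i) = 0"
        unfolding vector_add_component c B'_comp sp M_eq
        by (simp add: D_def scaleR_add_right mult.commute)
      then show ?thesis using s_pos[of i] by (simp add: add_eq_0_iff2)
    qed
    then have "(\<Sum>i\<in>UNIV. c i + B i xs) = - (1/2) *\<^sub>R (\<Sum>i\<in>UNIV. mat_act K (D r) $ i)"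
      by (simp add: scaleR_sum_right sum_negf)
    also have "\<dots> = 0" by (simp add: sum_laplacian[OF K_one K_sym])
    finally have "xs \<in> zeros_sum A B" using c(2) sp by (auto simp: zeros_sum_def)
    with Dp show ?thesis by blast
  qed
  ultimately show ?thesis by (intro exI[of _ "D zs"]) simp
qed

end
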